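(* Let $\Delta,k\in\mathbb{N}$. Then there exists a deterministic algorithm which, given a graph $G=(V,E)$ of maximum degree at most $\Delta$, a (complex-valued) symmetric $k\times k$ matrix $A$ such that $|A_{i,j}-1|\le 0.34/\Delta$ for all $i,j=1,\ldots,k$, and $\varepsilon>0$, computes a multiplicative $\varepsilon$-approximation to $p(G)(A)$ in time $(|V|/\varepsilon)^{O(1)}$.
   Context: For a symmetric matrix $A\in\mathbb{C}^{k\times k}$ (a spin model) and a graph $G=(V,E)$, the partition function of $A$ is $$p(G)(A)=\sum_{\phi:V\to[k]}\ \prod_{\{u,v\}\in E}A_{\phi(u),\phi(v)},$$ where $[k]=\{1,\ldots,k\}$. For non-zero complex numbers $q,\xi$, $\xi$ is called a multiplicative $\varepsilon$-approximation to $q$ if $e^{-\varepsilon}\le |q|/|\xi|\le e^{\varepsilon}$ and the angle between $\xi$ and $q$ (as vectors in $\mathbb{C}=\mathbb{R}^2$) is at most $\varepsilon$. The running time is an asymptotic bound; the constant implicit in the exponent $O(1)$ may depend on the fixed data $\Delta$ and $k$, but not on $G$, $A$ or $\varepsilon$.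
   Formalization: The time bound is (2+|V|/min(1,ε))^c, in unit-cost exact complex arithmetic, with c depending only on Δ and k (both positive): for ε>1 it is polynomial in |V| rather than |V|/ε, since the literal bound fails, e.g. for ε=|V|/2 it would demand constant time. *)

theory Defs
  imports
    "HOL-Analysis.Inner_Product"
    "HOL-Library.FuncSet"
    "Jordan_Normal_Form.Matrix"
begin

section \<open>Graphs and partition functions\<close>

definition simple_graph :: "'v set \<Rightarrow> 'v set set \<Rightarrow> bool" where
  "simple_graph V E \<longleftrightarrow>
     finite V \<and> (\<forall>e\<in>E. \<exists>u\<in>V. \<exists>v\<in>V. u \<noteq> v \<and> e = {u, v})"

definition vertex_degree :: "'v set set \<Rightarrow> 'v \<Rightarrow> nat" where
  "vertex_degree E v = card {e \<in> E. v \<in> e}"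

text \<open>The factor \<open>A\<^bsub>\<phi>(u),\<phi>(v)\<^esub>\<close> of the edge \<open>e = {u, v}\<close>. It is well defined only because \<open>A\<close>
  is symmetric; see \<open>edge_weight_eq\<close>. Colours are \<open>0, \<dots>, k - 1\<close>, as matrix indices start at 0.\<close>

definition edge_weight :: "complex mat \<Rightarrow> ('v \<Rightarrow> nat) \<Rightarrow> 'v set \<Rightarrow> complex" where
  "edge_weight A \<phi> e = (THE x. \<exists>u v. e = {u, v} \<and> x = A $$ (\<phi> u, \<phi> v))"

definition partition_function :: "'v set \<Rightarrow> 'v set set \<Rightarrow> complex mat \<Rightarrow> complex" where
  "partition_function V E A =
     (\<Sum>\<phi> \<in> V \<rightarrow>\<^sub>E {..<dim_row A}. \<Prod>e\<in>E. edge_weight A \<phi> e)"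

lemma edge_weight_eq:
  assumes A: "A \<in> carrier_mat k k" "transpose_mat A = A" and "\<phi> u < k" "\<phi> v < k"
  shows "edge_weight A \<phi> {u, v} = A $$ (\<phi> u, \<phi> v)"
proof -
  have "A $$ (\<phi> v, \<phi> u) = A $$ (\<phi> u, \<phi> v)"
    using assms by (metis carrier_matD index_transpose_mat(1))
  then show ?thesis
    unfolding edge_weight_def by (intro the_equality) (auto simp: doubleton_eq_iff)
qed

section \<open>Multiplicative approximation\<close>

definition angle :: "complex \<Rightarrow> complex \<Rightarrow> real" where
  "angle z w = arccos (inner z w / (norm z * norm w))"

definition mult_approx :: "real \<Rightarrow> complex \<Rightarrow> complex \<Rightarrow> bool" where
  "mult_approx \<epsilon> q \<xi> \<longleftrightarrow>
     q \<noteq> 0 \<and> \<xi> \<noteq> 0 \<and>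
     exp (- \<epsilon>) \<le> norm q / norm \<xi> \<and> norm q / norm \<xi> \<le> exp \<epsilon> \<and>
     angle \<xi> q \<le> \<epsilon>"

section \<open>Algorithms: programs for a random access machine over the complex numbers\<close>

text \<open>
  The running time in the theorem does not depend on the size of a description of the complex
  matrix or of \<open>\<epsilon>\<close>, so it refers to the arithmetic (unit-cost) model: a single step is an
  arithmetic operation on, or a comparison of the real parts of, exact complex numbers. This is the
  real RAM with a complex number held as a pair of reals, up to constant factors.

  A program has access to finitely many named arrays of natural numbers and of complex numbers;
  the scalar variables are the cells with index 0. Natural numbers serve as counters and indices.
  They only have addition and truncated subtraction: with unit cost for multiplication and division
  a RAM could do exponential work in polynomially many steps. For the same reason there is no
  rounding of complex numbers to natural numbers, and the only complex constants are natural numbers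
  and \<open>\<i>\<close>. With \<open>\<i>\<close> the imaginary part can be compared as well, as \<open>Im z = Re (- \<i> * z)\<close>.
\<close>

type_synonym name = string

datatype nexp =
    NConst nat
  | NCell name nexp
  | NAdd nexp nexp
  | NSub nexp nexp

datatype cexp =
    COfNat nexp
  | CImagUnit
  | CCell name nexp
  | CAdd cexp cexp
  | CSub cexp cexp
  | CMul cexp cexp
  | CDiv cexp cexp

datatype test =
    NLess nexp nexp
  | ReLess cexp cexp
  | TNot test
  | TAnd test test

datatype com =
    Skip
  | NAssign name nexp nexp
  | CAssign name nexp cexp
  | Seq com com
  | Cond test com com
  | While test com

record state =
  nmem :: "name \<Rightarrow> nat \<Rightarrow> nat"
  cmem :: "name \<Rightarrow> nat \<Rightarrow> complex"

fun nval :: "nexp \<Rightarrow> state \<Rightarrow> nat" where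
  "nval (NConst n) s = n"
| "nval (NCell x i) s = nmem s x (nval i s)"
| "nval (NAdd a b) s = nval a s + nval b s"
| "nval (NSub a b) s = nval a s - nval b s"

fun cval :: "cexp \<Rightarrow> state \<Rightarrow> complex" where
  "cval (COfNat a) s = of_nat (nval a s)"
| "cval CImagUnit s = \<i>"
| "cval (CCell x i) s = cmem s x (nval i s)"
| "cval (CAdd a b) s = cval a s + cval b s"
| "cval (CSub a b) s = cval a s - cval b s"
| "cval (CMul a b) s = cval a s * cval b s"
| "cval (CDiv a b) s = cval a s / cval b s"

fun tval :: "test \<Rightarrow> state \<Rightarrow> bool" where
  "tval (NLess a b) s \<longleftrightarrow> nval a s < nval b s"
| "tval (ReLess a b) s \<longleftrightarrow> Re (cval a s) < Re (cval b s)"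
| "tval (TNot b) s \<longleftrightarrow> \<not> tval b s"
| "tval (TAnd a b) s \<longleftrightarrow> tval a s \<and> tval b s"

text \<open>The cost of an evaluation is the number of operations and memory accesses, that is, the
  number of nodes of the expression.\<close>

fun ncost :: "nexp \<Rightarrow> nat" where
  "ncost (NConst n) = 1"
| "ncost (NCell x i) = 1 + ncost i"
| "ncost (NAdd a b) = 1 + ncost a + ncost b"
| "ncost (NSub a b) = 1 + ncost a + ncost b"

fun ccost :: "cexp \<Rightarrow> nat" where
  "ccost (COfNat a) = 1 + ncost a"
| "ccost CImagUnit = 1"
| "ccost (CCell x i) = 1 + ncost i"
| "ccost (CAdd a b) = 1 + ccost a + ccost b"
| "ccost (CSub a b) = 1 + ccost a + ccost b"
| "ccost (CMul a b) = 1 + ccost a + ccost b"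
| "ccost (CDiv a b) = 1 + ccost a + ccost b"

fun tcost :: "test \<Rightarrow> nat" where
  "tcost (NLess a b) = 1 + ncost a + ncost b"
| "tcost (ReLess a b) = 1 + ccost a + ccost b"
| "tcost (TNot b) = 1 + tcost b"
| "tcost (TAnd a b) = 1 + tcost a + tcost b"

definition nstore :: "name \<Rightarrow> nat \<Rightarrow> nat \<Rightarrow> state \<Rightarrow> state" where
  "nstore x i n s = s\<lparr>nmem := (nmem s)(x := (nmem s x)(i := n))\<rparr>"

definition cstore :: "name \<Rightarrow> nat \<Rightarrow> complex \<Rightarrow> state \<Rightarrow> state" where
  "cstore x i z s = s\<lparr>cmem := (cmem s)(x := (cmem s x)(i := z))\<rparr>"

text \<open>\<open>exec c s t s'\<close>: started in \<open>s\<close>, the program \<open>c\<close> halts in \<open>s'\<close> after exactly \<open>t\<close> steps.\<close>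

inductive exec :: "com \<Rightarrow> state \<Rightarrow> nat \<Rightarrow> state \<Rightarrow> bool" where
  Skip: "exec Skip s 1 s"
| NAssign: "exec (NAssign x i a) s (1 + ncost i + ncost a) (nstore x (nval i s) (nval a s) s)"
| CAssign: "exec (CAssign x i a) s (1 + ncost i + ccost a) (cstore x (nval i s) (cval a s) s)"
| Seq: "exec c s t s' \<Longrightarrow> exec d s' t' s'' \<Longrightarrow> exec (Seq c d) s (t + t') s''"
| CondTrue: "tval b s \<Longrightarrow> exec c s t s' \<Longrightarrow> exec (Cond b c d) s (1 + tcost b + t) s'"
| CondFalse: "\<not> tval b s \<Longrightarrow> exec d s t s' \<Longrightarrow> exec (Cond b c d) s (1 + tcost b + t) s'"
| WhileFalse: "\<not> tval b s \<Longrightarrow> exec (While b c) s (1 + tcost b) s"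
| WhileTrue: "tval b s \<Longrightarrow> exec c s t s' \<Longrightarrow> exec (While b c) s' t' s'' \<Longrightarrow>
    exec (While b c) s (1 + tcost b + t + t') s''"

inductive_cases exec_SkipE: "exec Skip s t s'"
inductive_cases exec_NAssignE: "exec (NAssign x i a) s t s'"
inductive_cases exec_CAssignE: "exec (CAssign x i a) s t s'"
inductive_cases exec_SeqE: "exec (Seq c d) s t s'"
inductive_cases exec_CondE: "exec (Cond b c d) s t s'"
inductive_cases exec_WhileE: "exec (While b c) s t s'"

lemma exec_deterministic:
  "exec c s t s' \<Longrightarrow> exec c s u r \<Longrightarrow> t = u \<and> s' = r"
proof (induction arbitrary: u r rule: exec.induct)
  case (Seq c s t s' d t' s'')
  from Seq.prems obtain v v' q where "u = v + v'" "exec c s v q" "exec d q v' r"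
    by (rule exec_SeqE)
  with Seq.IH show ?case by metis
next
  case (CondTrue b s c t s' d)
  from CondTrue.prems obtain v where "u = 1 + tcost b + v" "exec c s v r"
    using CondTrue.hyps(1) by (cases rule: exec_CondE) auto
  with CondTrue.IH show ?case by metis
next
  case (CondFalse b s d t s' c)
  from CondFalse.prems obtain v where "u = 1 + tcost b + v" "exec d s v r"
    using CondFalse.hyps(1) by (cases rule: exec_CondE) auto
  with CondFalse.IH show ?case by metis
next
  case (WhileFalse b s c)
  from WhileFalse.prems show ?case using WhileFalse.hyps by (cases rule: exec_WhileE) auto
next
  case (WhileTrue b s c t s' t' s'')
  from WhileTrue.prems obtain v v' q
    where "u = 1 + tcost b + v + v'" "exec c s v q" "exec (While b c) q v' r"
    using WhileTrue.hyps(1) by (cases rule: exec_WhileE) auto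
  with WhileTrue.IH show ?case by metis
qed (auto elim: exec_SkipE exec_NAssignE exec_CAssignE)

section \<open>Input and output\<close>

text \<open>A graph with vertex set \<open>{0, \<dots>, n - 1}\<close> is given by \<open>n\<close> and a list of its edges; the order of
  the list and the order of the two ends of an edge are arbitrary.\<close>

definition edge_list :: "(nat \<times> nat) list \<Rightarrow> nat set set \<Rightarrow> bool" where
  "edge_list es E \<longleftrightarrow>
     distinct (map (\<lambda>(u, v). {u, v}) es) \<and> set (map (\<lambda>(u, v). {u, v}) es) = E"

definition array_of :: "'a::zero list \<Rightarrow> nat \<Rightarrow> 'a" where
  "array_of xs i = (if i < length xs then xs ! i else 0)"

definition initial_state :: "nat \<Rightarrow> (nat \<times> nat) list \<Rightarrow> complex mat \<Rightarrow> real \<Rightarrow> state" where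
  "initial_state n es A \<epsilon> =
     \<lparr> nmem = (\<lambda>_ _. 0)
         (''vertices'' := array_of [n],
          ''edges'' := array_of [length es],
          ''end1'' := array_of (map fst es),
          ''end2'' := array_of (map snd es)),
       cmem = (\<lambda>_ _. 0)
         (''matrix'' := array_of [A $$ (i, j). i \<leftarrow> [0..<dim_row A], j \<leftarrow> [0..<dim_col A]],
          ''eps'' := array_of [complex_of_real \<epsilon>]) \<rparr>"

definition result :: "state \<Rightarrow> complex" where
  "result s = cmem s ''result'' 0"

end

theory Submission
  imports Defs "HOL-Complex_Analysis.Complex_Analysis"
begin

text \<open>
  Pin some vertices to colours and delete some edges. The ratio between the partition functions with
  a free vertex \<open>v\<close> pinned to \<open>i\<close>, before and after the deletion of all edges at \<open>v\<close>, is a product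
  over these edges, which are deleted one at a time; each factor is an average of \<open>A i c\<close> over the
  marginal of the other end, which is given by the same kind of ratio with one more pinned vertex.
  This is a recursion tree with branching at most \<open>k * \<Delta>\<close>. As long as the entries of \<open>A\<close> are within
  \<open>1.04 * 0.34 / \<Delta>\<close> of \<open>1\<close>, the logarithms of all ratios stay bounded by \<open>3/5\<close>, so that the weights
  lie in a narrow sector and no denominator vanishes, even if the tree is truncated.

  For \<open>A(z) = 1 + z (A - 1)\<close> a truncation at depth \<open>d\<close> changes the ratios only in order \<open>z ^ d\<close>, and the
  ratios are holomorphic and bounded for \<open>|z| < 1.04\<close>. By the maximum principle the error at \<open>z = 1\<close>
  is at most a constant times \<open>1.03 ^ (-d)\<close>. Hence depth \<open>O(log (n / \<epsilon>))\<close> suffices, the tree has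
  polynomially many nodes, and a depth-first traversal evaluates it.
\<close>


section \<open>Estimates for exponentials and logarithms\<close>

text \<open>The constants close a loop. Logarithms of norm at most 3/5 lie in a sector where the
  cosine is at least 1 - 0.18 = 41/50, so an average deviates from 1 by at most 221/625 * 50/41 / D,
  just below 69/160 / D. Since exp(-3/5) \<le> 91/160 = 1 - 69/160, Bernoulli bounds the logarithm
  of each edge factor by 3/5 / D, and at most D edges give 3/5 again. The bound does not involve the
  depth, and it allows D edges at every vertex, so roots need no separate treatment. No partition
  function is ever divided by: the identities are multiplicative, and the only denominators are sums
  of tree values. Nonvanishing of the partition function is therefore a by-product and not a
  prerequisite. Edges are deleted in the order of their indices, so one pointer per vertex records
  the deletions. A program without recursion can keep these pointers in an array and alter one of
  them at a time.\<close>

lemma exp_three_fifths: "exp (3/5 :: real) \<le> 2"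
  using exp_bound[of "3/5::real"] by (simp add: power2_eq_square)

lemma exp_minus_three_fifths: "exp (- (3/5) :: real) \<le> 91/160"
proof -
  have "(\<Sum>n<4. (3/5::real) ^ n / fact n) \<le> exp (3/5)"
    using sum_le_suminf[of "\<lambda>n. (3/5::real) ^ n /\<^sub>R fact n" "{..<4}"]
      summable_exp_generic[of "3/5::real"]
    by (simp add: exp_def field_simps)
  then have "160/91 \<le> exp (3/5::real)"
    by (simp add: eval_nat_numeral)
  then show ?thesis
    by (simp add: exp_minus field_simps)
qed

lemma cos_ge_quadratic: "1 - x\<^sup>2 / 2 \<le> cos (x::real)"
proof -
  have "cos x = 1 - 2 * (sin (x / 2))\<^sup>2"
    using cos_double_sin[of "x / 2"] by simp
  moreover have "(sin (x / 2))\<^sup>2 \<le> (x / 2)\<^sup>2"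
    using abs_sin_x_le_abs_x[of "x / 2"] by (metis abs_le_square_iff)
  ultimately show ?thesis
    by (simp add: power_divide)
qed

text \<open>The power series of \<open>- ln (1 - norm z)\<close> majorises that of
  \<open>Ln (1 + z)\<close> term by term.\<close>

lemma norm_Ln_le_minus_ln:
  fixes z :: complex
  assumes "norm z < 1"
  shows "norm (Ln (1 + z)) \<le> - ln (1 - norm z)"
proof -
  let ?f = "\<lambda>n. - ((- z) ^ n) / of_nat n" and ?g = "\<lambda>n. norm z ^ n / real n"
  have f: "?f sums Ln (1 + z)"
    using assms by (rule Ln_series')
  have "(\<lambda>n. - ((norm z) ^ n) / of_nat n) sums ln (1 - norm z)"
    using ln_series'[of "- norm z"] assms by simp
  from sums_minus[OF this] have g: "?g sums - ln (1 - norm z)"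
    by simp
  have "norm (suminf ?f) \<le> suminf ?g"
    using sums_summable[OF g] by (intro norm_suminf_le) (simp_all add: norm_divide norm_power)
  then show ?thesis
    using f g by (simp add: sums_iff)
qed

text \<open>Bernoulli gives \<open>(1 - norm h) ^ D \<ge> 91/160 \<ge> exp (- (3/5))\<close>; after
  taking logarithms, division by \<open>D\<close> costs no further constant.\<close>

lemma one_plus_eq_exp:
  fixes h :: complex
  assumes D: "1 \<le> D" and h: "norm h \<le> 69 / 160 / real D"
  shows "\<exists>g. 1 + h = exp g \<and> norm g \<le> 3 / 5 / real D"
proof -
  have "69/160 / real D \<le> 69/160"
    using D by (simp add: divide_le_eq)
  then have lt: "norm h < 1"
    using h by linarith
  then have nz: "1 + h \<noteq> 0"
    by (metis add_eq_0_iff norm_minus_cancel norm_one order_less_irrefl)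
  have "real D * ln (1 - norm h) = ln ((1 - norm h) ^ D)"
    using lt by (simp add: ln_realpow)
  also have "(1 - norm h) ^ D \<ge> 1 + real D * (- norm h)"
    using Bernoulli_inequality[of "- norm h" D] lt by simp
  then have "(1 - norm h) ^ D \<ge> 91/160"
    using h D by (simp add: field_simps)
  then have "exp (- (3/5)) \<le> (1 - norm h) ^ D"
    using exp_minus_three_fifths by linarith
  then have "ln ((1 - norm h) ^ D) \<ge> - (3/5)"
    using lt by (subst ln_ge_iff) auto
  finally have "- ln (1 - norm h) \<le> 3 / 5 / real D"
    using D by (simp add: field_simps)
  with norm_Ln_le_minus_ln[OF lt] nz show ?thesis
    by (intro exI[of _ "Ln (1 + h)"]) auto
qed

text \<open>All summands lie in a sector of half-angle 3/5 about the positive axis, where the real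
  part is at least 41/50 of the modulus, and positive real parts do not cancel.\<close>

lemma norm_sum_exp_ge:
  fixes g :: "'a \<Rightarrow> complex"
  assumes "\<And>c. c \<in> C \<Longrightarrow> norm (g c) \<le> 3/5"
  shows "41/50 * (\<Sum>c\<in>C. norm (exp (g c))) \<le> norm (\<Sum>c\<in>C. exp (g c))"
proof -
  have "41/50 * norm (exp (g c)) \<le> Re (exp (g c))" if "c \<in> C" for c
  proof -
    have "(Im (g c))\<^sup>2 \<le> (3/5)\<^sup>2"
      using assms[OF that] abs_Im_le_cmod[of "g c"] by (intro power2_le_iff_abs_le[THEN iffD2]) auto
    then have "41/50 \<le> cos (Im (g c))"
      using cos_ge_quadratic[of "Im (g c)"] by (simp add: power2_eq_square)
    then have "exp (Re (g c)) * (41/50) \<le> exp (Re (g c)) * cos (Im (g c))"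
      by (intro mult_left_mono) auto
    then show ?thesis
      by (simp add: Re_exp mult.commute)
  qed
  then have "41/50 * (\<Sum>c\<in>C. norm (exp (g c))) \<le> (\<Sum>c\<in>C. Re (exp (g c)))"
    unfolding sum_distrib_left by (rule sum_mono)
  also have "\<dots> \<le> norm (\<Sum>c\<in>C. exp (g c))"
    using complex_Re_le_cmod[of "\<Sum>c\<in>C. exp (g c)"] by simp
  finally show ?thesis .
qed

section \<open>Agreement of holomorphic functions to a given order\<close>

text \<open>Agreement to order \<open>m\<close> at 0, encoded by a holomorphic cofactor: it can be
  written down for sums, products and quotients, and the maximum principle is applied to it
  directly.\<close>

definition agree :: "real \<Rightarrow> nat \<Rightarrow> (complex \<Rightarrow> complex) \<Rightarrow> (complex \<Rightarrow> complex) \<Rightarrow> bool" where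
  "agree R m f g \<longleftrightarrow> f holomorphic_on ball 0 R \<and> g holomorphic_on ball 0 R \<and>
     (\<exists>h. h holomorphic_on ball 0 R \<and> (\<forall>z\<in>ball 0 R. f z - g z = z ^ m * h z))"

lemma agreeI:
  assumes "f holomorphic_on ball 0 R" "g holomorphic_on ball 0 R" "h holomorphic_on ball 0 R"
    "\<And>z. z \<in> ball 0 R \<Longrightarrow> f z - g z = z ^ m * h z"
  shows "agree R m f g"
  using assms unfolding agree_def by blast

lemma agreeE:
  assumes "agree R m f g"
  obtains h where "f holomorphic_on ball 0 R" "g holomorphic_on ball 0 R" "h holomorphic_on ball 0 R"
    "\<And>z. z \<in> ball 0 R \<Longrightarrow> f z - g z = z ^ m * h z"
  using assms unfolding agree_def by blast

lemma agree_refl: "f holomorphic_on ball 0 R \<Longrightarrow> agree R m f f"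
  by (rule agreeI[where h = "\<lambda>_. 0"]) auto

lemma agree_zero:
  "f holomorphic_on ball 0 R \<Longrightarrow> g holomorphic_on ball 0 R \<Longrightarrow> agree R 0 f g"
  by (rule agreeI[where h = "\<lambda>z. f z - g z"]) (auto intro!: holomorphic_intros)

lemma agree_add:
  assumes "agree R m f g" "agree R m f' g'"
  shows "agree R m (\<lambda>z. f z + f' z) (\<lambda>z. g z + g' z)"
proof -
  obtain h h' where h: "f holomorphic_on ball 0 R" "g holomorphic_on ball 0 R" "h holomorphic_on ball 0 R"
    "\<And>z. z \<in> ball 0 R \<Longrightarrow> f z - g z = z ^ m * h z"
    and h': "f' holomorphic_on ball 0 R" "g' holomorphic_on ball 0 R" "h' holomorphic_on ball 0 R"
    "\<And>z. z \<in> ball 0 R \<Longrightarrow> f' z - g' z = z ^ m * h' z"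
    using assms by (metis agreeE)
  show ?thesis
  proof (rule agreeI[where h = "\<lambda>z. h z + h' z"])
    fix z :: complex assume "z \<in> ball 0 R"
    then show "f z + f' z - (g z + g' z) = z ^ m * (h z + h' z)"
      using h(4)[of z] h'(4)[of z] by (simp add: algebra_simps)
  qed (intro holomorphic_intros h h')+
qed

lemma agree_mult:
  assumes "agree R m f g" "agree R m f' g'"
  shows "agree R m (\<lambda>z. f z * f' z) (\<lambda>z. g z * g' z)"
proof -
  obtain h h' where h: "f holomorphic_on ball 0 R" "g holomorphic_on ball 0 R" "h holomorphic_on ball 0 R"
    "\<And>z. z \<in> ball 0 R \<Longrightarrow> f z - g z = z ^ m * h z"
    and h': "f' holomorphic_on ball 0 R" "g' holomorphic_on ball 0 R" "h' holomorphic_on ball 0 R"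
    "\<And>z. z \<in> ball 0 R \<Longrightarrow> f' z - g' z = z ^ m * h' z"
    using assms by (metis agreeE)
  show ?thesis
  proof (rule agreeI[where h = "\<lambda>z. f z * h' z + h z * g' z"])
    fix z :: complex assume z: "z \<in> ball 0 R"
    have "f z * f' z - g z * g' z = f z * (f' z - g' z) + (f z - g z) * g' z"
      by (simp add: algebra_simps)
    then show "f z * f' z - g z * g' z = z ^ m * (f z * h' z + h z * g' z)"
      using h(4)[OF z] h'(4)[OF z] by (simp add: algebra_simps)
  qed (intro holomorphic_intros h h')+
qed

lemma agree_divide:
  assumes "agree R m f g" "agree R m f' g'"
    and nz: "\<And>z. z \<in> ball 0 R \<Longrightarrow> f' z \<noteq> 0" "\<And>z. z \<in> ball 0 R \<Longrightarrow> g' z \<noteq> 0"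
  shows "agree R m (\<lambda>z. f z / f' z) (\<lambda>z. g z / g' z)"
proof -
  obtain h h' where h: "f holomorphic_on ball 0 R" "g holomorphic_on ball 0 R" "h holomorphic_on ball 0 R"
    "\<And>z. z \<in> ball 0 R \<Longrightarrow> f z - g z = z ^ m * h z"
    and h': "f' holomorphic_on ball 0 R" "g' holomorphic_on ball 0 R" "h' holomorphic_on ball 0 R"
    "\<And>z. z \<in> ball 0 R \<Longrightarrow> f' z - g' z = z ^ m * h' z"
    using assms(1,2) by (metis agreeE)
  show ?thesis
  proof (rule agreeI[where h = "\<lambda>z. (h z * g' z - g z * h' z) / (f' z * g' z)"])
    fix z :: complex assume z: "z \<in> ball 0 R"
    have "f z / f' z - g z / g' z = ((f z - g z) * g' z - g z * (f' z - g' z)) / (f' z * g' z)"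
      using nz[OF z] by (simp add: field_simps)
    then show "f z / f' z - g z / g' z = z ^ m * ((h z * g' z - g z * h' z) / (f' z * g' z))"
      using h(4)[OF z] h'(4)[OF z] by (simp add: algebra_simps)
  qed (use nz in \<open>auto intro!: holomorphic_intros h h'\<close>)
qed

lemma agree_sum:
  assumes "finite I" "\<And>i. i \<in> I \<Longrightarrow> agree R m (f i) (g i)"
  shows "agree R m (\<lambda>z. \<Sum>i\<in>I. f i z) (\<lambda>z. \<Sum>i\<in>I. g i z)"
  using assms by (induction I rule: finite_induct) (auto intro: agree_refl agree_add)

lemma agree_prod:
  assumes "finite I" "\<And>i. i \<in> I \<Longrightarrow> agree R m (f i) (g i)"
  shows "agree R m (\<lambda>z. \<Prod>i\<in>I. f i z) (\<lambda>z. \<Prod>i\<in>I. g i z)"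
  using assms by (induction I rule: finite_induct) (auto intro: agree_refl agree_mult)

text \<open>The source of the gain of one order per level of the tree.\<close>

lemma agree_one_plus:
  assumes "agree R m f g"
  shows "agree R (Suc m) (\<lambda>z. 1 + z * f z) (\<lambda>z. 1 + z * g z)"
proof -
  obtain h where h: "f holomorphic_on ball 0 R" "g holomorphic_on ball 0 R" "h holomorphic_on ball 0 R"
    "\<And>z. z \<in> ball 0 R \<Longrightarrow> f z - g z = z ^ m * h z"
    using assms by (metis agreeE)
  show ?thesis
  proof (rule agreeI[where h = h])
    fix z :: complex assume z: "z \<in> ball 0 R"
    have "1 + z * f z - (1 + z * g z) = z * (f z - g z)"
      by (simp add: algebra_simps)
    then show "1 + z * f z - (1 + z * g z) = z ^ Suc m * h z"
      using h(4)[OF z] by simp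
  qed (intro holomorphic_intros h)+
qed

lemma agree_cong:
  assumes "agree R m f g" "\<And>z. z \<in> ball 0 R \<Longrightarrow> f z = f' z" "\<And>z. z \<in> ball 0 R \<Longrightarrow> g z = g' z"
  shows "agree R m f' g'"
proof -
  obtain h where h: "f holomorphic_on ball 0 R" "g holomorphic_on ball 0 R" "h holomorphic_on ball 0 R"
    "\<And>z. z \<in> ball 0 R \<Longrightarrow> f z - g z = z ^ m * h z"
    using assms by (metis agreeE)
  moreover have "f' holomorphic_on ball 0 R" "g' holomorphic_on ball 0 R"
    using h(1,2) assms(2,3) by (metis holomorphic_transform)+
  ultimately show ?thesis
    using assms(2,3) by (intro agreeI[where h = h]) auto
qed

text \<open>A Schwarz lemma argument: on the circle of radius \<open>r\<close> the cofactor is at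
  most \<open>B / r ^ m\<close>, and the point 1 lies inside.\<close>

lemma agree_diff_le:
  assumes "agree R m f g" and r: "1 < r" "r < R"
    and B: "\<And>z. z \<in> ball 0 R \<Longrightarrow> norm (f z - g z) \<le> B"
  shows "norm (f 1 - g 1) \<le> B / r ^ m"
proof -
  obtain h where h: "h holomorphic_on ball 0 R"
    "\<And>z. z \<in> ball 0 R \<Longrightarrow> f z - g z = z ^ m * h z"
    using assms(1) by (metis agreeE)
  have "norm (h 1) \<le> B / r ^ m"
  proof (rule maximum_modulus_frontier[of h "cball 0 r"])
    show "h holomorphic_on interior (cball 0 r)"
      using r by (intro holomorphic_on_subset[OF h(1)]) auto
    show "continuous_on (closure (cball 0 r)) h"
      using r by (intro holomorphic_on_imp_continuous_on holomorphic_on_subset[OF h(1)]) auto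
    fix z :: complex assume "z \<in> frontier (cball 0 r)"
    then have z: "norm z = r" "z \<in> ball 0 R"
      using r by auto
    then have "r ^ m * norm (h z) \<le> B"
      using h(2)[of z] B[of z] by (simp add: norm_mult norm_power)
    then show "norm (h z) \<le> B / r ^ m"
      using r by (simp add: field_simps)
  qed (use r in auto)
  then show ?thesis
    using h(2)[of 1] r by simp
qed

section \<open>The computation tree\<close>

text \<open>The expectation of \<open>a i c\<close> when \<open>c\<close> has the complex
  "distribution" proportional to \<open>f\<close>.\<close>

definition average :: "nat \<Rightarrow> (nat \<Rightarrow> nat \<Rightarrow> complex) \<Rightarrow> nat \<Rightarrow> (nat \<Rightarrow> complex) \<Rightarrow> complex" where
  "average k a i f = (\<Sum>c<k. a i c * f c) / (\<Sum>c<k. f c)"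

text \<open>The radius \<open>221/625\<close> is \<open>1.04 * 0.34\<close>: the slack is what makes the truncation error decay.\<close>

definition close_to_one :: "nat \<Rightarrow> nat \<Rightarrow> (nat \<Rightarrow> nat \<Rightarrow> complex) \<Rightarrow> bool" where
  "close_to_one D k a \<longleftrightarrow> (\<forall>i<k. \<forall>j<k. norm (a i j - 1) \<le> 221 / 625 / real D)"

lemma sum_exp_lower:
  fixes f :: "nat \<Rightarrow> complex"
  assumes "\<And>c. c < k \<Longrightarrow> \<exists>g. f c = exp g \<and> norm g \<le> 3 / 5"
  shows "41/50 * (\<Sum>c<k. norm (f c)) \<le> norm (\<Sum>c<k. f c)"
    and "\<And>c. c < k \<Longrightarrow> 1 / 2 \<le> norm (f c) \<and> norm (f c) \<le> 2"
proof -
  obtain g where g: "\<And>c. c < k \<Longrightarrow> f c = exp (g c) \<and> norm (g c) \<le> 3 / 5"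
    using assms by metis
  have "(\<Sum>c<k. f c) = (\<Sum>c<k. exp (g c))" "(\<Sum>c<k. norm (f c)) = (\<Sum>c<k. norm (exp (g c)))"
    using g by auto
  then show "41/50 * (\<Sum>c<k. norm (f c)) \<le> norm (\<Sum>c<k. f c)"
    using norm_sum_exp_ge[of "{..<k}" g] g by simp
  fix c assume c: "c < k"
  have "\<bar>Re (g c)\<bar> \<le> 3 / 5"
    using g[OF c] abs_Re_le_cmod[of "g c"] by linarith
  then have "exp (- (3/5)) \<le> norm (f c)" "norm (f c) \<le> exp (3/5)"
    using g[OF c] by auto
  moreover have "1 / 2 \<le> exp (- (3/5) :: real)"
    using exp_three_fifths by (simp add: exp_minus field_simps)
  ultimately show "1 / 2 \<le> norm (f c) \<and> norm (f c) \<le> 2"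
    using exp_three_fifths by linarith
qed

lemma sum_exp_norm_ge:
  fixes f :: "nat \<Rightarrow> complex"
  assumes "\<And>c. c < k \<Longrightarrow> \<exists>g. f c = exp g \<and> norm g \<le> 3 / 5"
  shows "41/100 * real k \<le> norm (\<Sum>c<k. f c)"
proof -
  have "(\<Sum>c<k. 1 / 2 :: real) \<le> (\<Sum>c<k. norm (f c))"
    using sum_exp_lower(2)[of k f] assms by (intro sum_mono) auto
  then show ?thesis
    using sum_exp_lower(1)[of k f] assms by simp
qed

text \<open>Subtracting 1 turns \<open>a i c\<close> into \<open>a i c - 1\<close> in the numerator.
  The sector bound for the denominator costs a factor 50/41, and 221/625 * 50/41 is just below
  69/160.\<close>

lemma average_close:
  assumes k: "1 \<le> k" and D: "1 \<le> D" and a: "close_to_one D k a" and i: "i < k"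
    and f: "\<And>c. c < k \<Longrightarrow> \<exists>g. f c = exp g \<and> norm g \<le> 3 / 5"
  shows "norm (average k a i f - 1) \<le> 69 / 160 / real D"
proof -
  let ?N = "\<Sum>c<k. norm (f c)" and ?\<delta> = "221 / 625 / real D"
  note low = sum_exp_lower(1)[of k f, OF f]
  have pos: "0 < norm (\<Sum>c<k. f c)"
    using sum_exp_norm_ge[of k f, OF f] k by linarith
  then have nz: "(\<Sum>c<k. f c) \<noteq> 0"
    by auto
  have "average k a i f - 1 = (\<Sum>c<k. (a i c - 1) * f c) / (\<Sum>c<k. f c)"
    using nz by (simp add: average_def field_simps sum_subtractf)
  moreover have "norm (\<Sum>c<k. (a i c - 1) * f c) \<le> ?\<delta> * ?N"
    unfolding sum_distrib_left
  proof (rule sum_norm_le)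
    fix c assume "c \<in> {..<k}"
    then have "norm (a i c - 1) \<le> ?\<delta>"
      using a i by (simp only: close_to_one_def lessThan_iff)
    then show "norm ((a i c - 1) * f c) \<le> ?\<delta> * norm (f c)"
      unfolding norm_mult by (intro mult_right_mono) auto
  qed
  moreover have "?\<delta> * ?N \<le> 69 / 160 / real D * norm (\<Sum>c<k. f c)"
  proof -
    have "221 / 625 * ?N \<le> 69 / 160 * norm (\<Sum>c<k. f c)"
      using low pos by linarith
    then have "221 / 625 * ?N / real D \<le> 69 / 160 * norm (\<Sum>c<k. f c) / real D"
      by (rule divide_right_mono) simp
    then show ?thesis by (simp only: times_divide_eq_left)
  qed
  ultimately show ?thesis
    using pos by (simp only: norm_divide pos_divide_le_eq)
qed

locale bounded_graph =
  fixes n M k D :: nat and x y :: "nat \<Rightarrow> nat"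
  assumes ends: "e < M \<Longrightarrow> x e < n \<and> y e < n \<and> x e \<noteq> y e"
    and degree: "v < n \<Longrightarrow> card {e. e < M \<and> (x e = v \<or> y e = v)} \<le> D"
    and k_ge_1: "1 \<le> k" and D_ge_1: "1 \<le> D"
begin

definition inc :: "nat \<Rightarrow> nat \<Rightarrow> bool" where
  "inc e v \<longleftrightarrow> x e = v \<or> y e = v"

text \<open>This form needs only the operations of the machine on natural numbers. The value is
  meaningless unless \<open>inc e v\<close>, and \<open>factor\<close> ignores it in that
  case.\<close>

definition oth :: "nat \<Rightarrow> nat \<Rightarrow> nat" where
  "oth e v = x e + y e - v"

lemma oth_less: "e < M \<Longrightarrow> inc e v \<Longrightarrow> oth e v < n"
  and oth_neq: "e < M \<Longrightarrow> inc e v \<Longrightarrow> oth e v \<noteq> v"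
  using ends[of e] by (auto simp: inc_def oth_def)

text \<open>A configuration consists of \<open>S\<close> and \<open>q\<close>: the vertex \<open>u\<close> is free if \<open>S u = 0\<close> and pinned to the
  colour \<open>i\<close> if \<open>S u = Suc i\<close>; the edges at \<open>u\<close> with an index below \<open>q u\<close> are deleted. The edge \<open>e\<close>
  contributes to \<open>W\<close> the ratio of the partition functions before and after its deletion, when
  \<open>v\<close> is pinned to \<open>i\<close> and \<open>f\<close> is proportional to the marginal of the other end.\<close>

definition factor where
  "factor a S q v i e f =
     (if \<not> inc e v \<or> e < q (oth e v) then 1
      else if S (oth e v) \<noteq> 0 then a i (S (oth e v) - 1) else average k a i f :: complex)"

text \<open>Depth 0 treats all colours of \<open>v\<close> as equally likely. In the subtree of
  \<open>e\<close> the edges at \<open>v\<close> up to and including \<open>e\<close> are gone,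
  hence the pointer \<open>Suc e\<close>.\<close>

primrec W :: "(nat \<Rightarrow> nat \<Rightarrow> complex) \<Rightarrow> nat \<Rightarrow> (nat \<Rightarrow> nat) \<Rightarrow> (nat \<Rightarrow> nat) \<Rightarrow> nat \<Rightarrow> nat \<Rightarrow> complex" where
  "W a 0 S q v i = 1"
| "W a (Suc d) S q v i =
     (\<Prod>e\<in>{q v..<M}. factor a S q v i e (W a d (S(v := Suc i)) (q(v := Suc e)) (oth e v)))"

lemma W_exp:
  assumes a: "close_to_one D k a" and "\<And>u. S u \<le> k" "v < n" "i < k"
  shows "\<exists>g. W a d S q v i = exp g \<and> norm g \<le> 3 / 5"
  using assms(2-)
proof (induction d arbitrary: S q v i)
  case 0
  show ?case by (intro exI[of _ 0]) simp
next
  case (Suc d)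
  let ?F = "\<lambda>e. factor a S q v i e (W a d (S(v := Suc i)) (q(v := Suc e)) (oth e v))"
  have D: "0 < real D" and delta: "221 / 625 / real D \<le> 69 / 160 / real D"
    using D_ge_1 by (auto simp: field_simps)
  have "\<exists>g. ?F e = exp g \<and> norm g \<le> (if inc e v then 3 / 5 / real D else 0)" if e: "e < M" for e
  proof (cases "\<not> inc e v \<or> e < q (oth e v)")
    case True
    then have "?F e = exp 0" by (simp add: factor_def)
    then show ?thesis using D by (intro exI[of _ 0]) simp
  next
    case False
    have "norm (?F e - 1) \<le> 69 / 160 / real D"
    proof (cases "S (oth e v) = 0")
      case True
      have "norm (average k a i (W a d (S(v := Suc i)) (q(v := Suc e)) (oth e v)) - 1) \<le> 69 / 160 / real D"
        using Suc.prems oth_less[OF e] False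
        by (intro average_close[OF k_ge_1 D_ge_1 a] Suc.IH) auto
      then show ?thesis using True False by (simp add: factor_def)
    next
      case S: False
      moreover have "S (oth e v) - 1 < k"
        using S Suc.prems(1)[of "oth e v"] by linarith
      ultimately have "norm (a i (S (oth e v) - 1) - 1) \<le> 221 / 625 / real D"
        using a Suc.prems(3) by (simp only: close_to_one_def)
      then show ?thesis
        using delta False S by (simp add: factor_def)
    qed
    from one_plus_eq_exp[OF D_ge_1 this] obtain g
      where "1 + (?F e - 1) = exp g" "norm g \<le> 3 / 5 / real D"
      by blast
    with False show ?thesis by (intro exI[of _ g]) auto
  qed
  then obtain g where g: "\<And>e. e < M \<Longrightarrow> ?F e = exp (g e) \<and> norm (g e) \<le> (if inc e v then 3 / 5 / real D else 0)"
    by meson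
  have "W a (Suc d) S q v i = exp (\<Sum>e\<in>{q v..<M}. g e)"
    using g by (simp add: exp_sum)
  moreover have "norm (\<Sum>e\<in>{q v..<M}. g e) \<le> 3 / 5"
  proof -
    have "norm (\<Sum>e\<in>{q v..<M}. g e) \<le> (\<Sum>e\<in>{q v..<M}. if inc e v then 3 / 5 / real D else 0)"
      using g by (intro sum_norm_le) auto
    also have "\<dots> \<le> (\<Sum>e<M. if inc e v then 3 / 5 / real D else 0)"
      using D by (intro sum_mono2) auto
    also have "\<dots> = real (card {e. e < M \<and> inc e v}) * (3 / 5 / real D)"
    proof -
      have "{..<M} \<inter> {e. inc e v} = {e. e < M \<and> inc e v}"
        by auto
      then show ?thesis by (simp add: sum.If_cases)
    qed
    also have "\<dots> \<le> real D * (3 / 5 / real D)"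
      using degree[OF Suc.prems(2)] D by (intro mult_right_mono) (auto simp: inc_def)
    finally show ?thesis using D by simp
  qed
  ultimately show ?case by blast
qed

lemma W_sum_nonzero:
  assumes "close_to_one D k a" "\<And>u. S u \<le> k" "v < n"
  shows "(\<Sum>c<k. W a d S q v c) \<noteq> 0"
proof -
  have "41/100 * real k \<le> norm (\<Sum>c<k. W a d S q v c)"
    using assms W_exp by (intro sum_exp_norm_ge) auto
  then show ?thesis using k_ge_1 by auto
qed

end

section \<open>Partition functions of configurations\<close>

context bounded_graph
begin

definition weight :: "(nat \<Rightarrow> nat \<Rightarrow> complex) \<Rightarrow> (nat \<Rightarrow> nat) \<Rightarrow> (nat \<Rightarrow> nat) \<Rightarrow> complex" where
  "weight a q \<phi> = (\<Prod>e<M. if q (x e) \<le> e \<and> q (y e) \<le> e then a (\<phi> (x e)) (\<phi> (y e)) else 1)"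

definition colourings :: "(nat \<Rightarrow> nat) \<Rightarrow> (nat \<Rightarrow> nat) set" where
  "colourings S = {\<phi> \<in> {..<n} \<rightarrow>\<^sub>E {..<k}. \<forall>w<n. S w \<noteq> 0 \<longrightarrow> S w = Suc (\<phi> w)}"

definition Z :: "(nat \<Rightarrow> nat \<Rightarrow> complex) \<Rightarrow> (nat \<Rightarrow> nat) \<Rightarrow> (nat \<Rightarrow> nat) \<Rightarrow> complex" where
  "Z a S q = (\<Sum>\<phi>\<in>colourings S. weight a q \<phi>)"

lemma finite_colourings: "finite (colourings S)"
  unfolding colourings_def
  by (rule finite_subset[of _ "{..<n} \<rightarrow>\<^sub>E {..<k}"]) (auto intro: finite_PiE)

lemma colouring_less: "\<phi> \<in> colourings S \<Longrightarrow> w < n \<Longrightarrow> \<phi> w < k"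
  by (auto simp: colourings_def PiE_iff)

lemma colouring_pinned: "\<phi> \<in> colourings S \<Longrightarrow> w < n \<Longrightarrow> S w \<noteq> 0 \<Longrightarrow> \<phi> w = S w - 1"
  unfolding colourings_def by fastforce

lemma colourings_upd:
  assumes "u < n" "S u = 0"
  shows "colourings (S(u := Suc c)) = {\<phi> \<in> colourings S. \<phi> u = c}"
proof -
  have "(\<forall>w<n. (S(u := Suc c)) w \<noteq> 0 \<longrightarrow> (S(u := Suc c)) w = Suc (\<phi> w)) \<longleftrightarrow>
    (\<forall>w<n. S w \<noteq> 0 \<longrightarrow> S w = Suc (\<phi> w)) \<and> \<phi> u = c" for \<phi>
    using assms by (metis fun_upd_other fun_upd_same nat.distinct(1) nat.inject)
  then show ?thesis
    unfolding colourings_def by blast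
qed

lemma Z_split:
  assumes "u < n" "S u = 0"
  shows "Z a S q = (\<Sum>c<k. Z a (S(u := Suc c)) q)"
proof -
  have "Z a S q = (\<Sum>c<k. \<Sum>\<phi> | \<phi> \<in> colourings S \<and> \<phi> u = c. weight a q \<phi>)"
    unfolding Z_def using assms finite_colourings colouring_less
    by (intro sum.group[symmetric]) auto
  then show ?thesis
    unfolding Z_def by (simp add: colourings_upd[of u S, OF assms])
qed

text \<open>No surviving edge touches \<open>u\<close>, so recolouring \<open>u\<close> is a
  weight-preserving bijection of the colourings.\<close>

lemma Z_pinned_isolated:
  assumes u: "u < n" "M \<le> q u" "S u = 0" and c: "c < k" "c' < k"
  shows "Z a (S(u := Suc c)) q = Z a (S(u := Suc c')) q"
  unfolding Z_def
proof (rule sum.reindex_bij_witness[of _ "\<lambda>\<phi>. \<phi>(u := c)" "\<lambda>\<phi>. \<phi>(u := c')"])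
  fix \<phi>
  show "weight a q (\<phi>(u := c')) = weight a q \<phi>"
    unfolding weight_def
  proof (rule prod.cong)
    fix e assume "e \<in> {..<M}"
    then show "(if q (x e) \<le> e \<and> q (y e) \<le> e then a ((\<phi>(u := c')) (x e)) ((\<phi>(u := c')) (y e)) else 1) =
      (if q (x e) \<le> e \<and> q (y e) \<le> e then a (\<phi> (x e)) (\<phi> (y e)) else 1)"
      using u(2) by (cases "x e = u"; cases "y e = u") auto
  qed simp
qed (use u c in \<open>auto simp: colourings_def PiE_iff extensional_def\<close>)

lemma Z_isolated:
  assumes u: "u < n" "M \<le> q u" and S: "S u = 0" and c: "c < k"
  shows "Z a S q = of_nat k * Z a (S(u := Suc c)) q"
proof -
  have "Z a S q = (\<Sum>c'<k. Z a (S(u := Suc c)) q)"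
    unfolding Z_split[of u S a q, OF u(1) S]
    using assms by (intro sum.cong Z_pinned_isolated) auto
  then show ?thesis by simp
qed

text \<open>Either \<open>e\<close> does not touch \<open>v\<close> or it is already deleted at its
  other end, so moving the pointer of \<open>v\<close> past it removes nothing.\<close>

lemma weight_skip:
  assumes "q v = e" "\<not> inc e v \<or> e < q (oth e v)"
  shows "weight a q \<phi> = weight a (q(v := Suc e)) \<phi>"
  unfolding weight_def
proof (rule prod.cong)
  fix f assume "f \<in> {..<M}"
  then have "x f \<noteq> y f" using ends by auto
  have "(q(v := Suc e)) w \<le> f \<longleftrightarrow> q w \<le> f \<and> \<not> (w = v \<and> f = e)" for w
    using assms(1) by auto
  moreover have "\<not> ((x f = v \<or> y f = v) \<and> f = e)" if "q (x f) \<le> f" "q (y f) \<le> f"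
    using assms that by (auto simp: inc_def oth_def)
  ultimately show "(if q (x f) \<le> f \<and> q (y f) \<le> f then a (\<phi> (x f)) (\<phi> (y f)) else 1) =
    (if (q(v := Suc e)) (x f) \<le> f \<and> (q(v := Suc e)) (y f) \<le> f then a (\<phi> (x f)) (\<phi> (y f)) else 1)"
    by metis
qed simp

lemma weight_step:
  assumes e: "e < M" and q: "q v = e" "q (oth e v) \<le> e" and inc: "inc e v"
    and sym: "\<forall>i<k. \<forall>j<k. a i j = a j i" and \<phi>: "\<phi> \<in> colourings S"
  shows "weight a q \<phi> = a (\<phi> v) (\<phi> (oth e v)) * weight a (q(v := Suc e)) \<phi>"
proof -
  let ?t = "\<lambda>q f. if q (x f) \<le> f \<and> q (y f) \<le> f then a (\<phi> (x f)) (\<phi> (y f)) else 1"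
  \<comment> \<open>The list may name \<open>v\<close> as the first or the second end of
    \<open>e\<close>; symmetry of \<open>a\<close> reconciles the two cases.\<close>
  have xy: "x e = v \<and> y e = oth e v \<or> x e = oth e v \<and> y e = v"
    using inc by (auto simp: inc_def oth_def)
  have "\<phi> (x e) < k" "\<phi> (y e) < k"
    using colouring_less[OF \<phi>] ends[OF e] by auto
  then have "?t q e = a (\<phi> v) (\<phi> (oth e v))"
    using xy q sym by auto
  moreover have "?t (q(v := Suc e)) e = 1"
    using xy by auto
  moreover have "(\<Prod>f\<in>{..<M} - {e}. ?t q f) = (\<Prod>f\<in>{..<M} - {e}. ?t (q(v := Suc e)) f)"
  proof (rule prod.cong)
    fix f assume "f \<in> {..<M} - {e}"
    then have "(q(v := Suc e)) w \<le> f \<longleftrightarrow> q w \<le> f" for w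
      using q by auto
    then show "?t q f = ?t (q(v := Suc e)) f" by simp
  qed simp
  ultimately show ?thesis
    unfolding weight_def using e by (simp add: prod.remove[of "{..<M}" e])
qed

text \<open>Split by the colour \<open>c\<close> of a free other end: \<open>Z\<close> before and
  after the deletion of \<open>e\<close> are sums of the same terms, with and without the factor
  \<open>a i c\<close>, so their ratio is the average.\<close>

lemma Z_factor:
  assumes a: "close_to_one D k a" and sym: "\<forall>i<k. \<forall>j<k. a i j = a j i"
    and S: "\<And>u. S u \<le> k" "S v = Suc i" and v: "v < n" and e: "e < M" and q: "q v = e"
    and f: "\<And>u c. u < n \<Longrightarrow> S u = 0 \<Longrightarrow> q u \<le> M \<Longrightarrow> c < k \<Longrightarrow>
      Z a (S(u := Suc c)) (q(v := Suc e)) =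
      f u c * Z a (S(u := Suc c)) (q(v := Suc e, u := M))"
    and nz: "\<And>u. u < n \<Longrightarrow> (\<Sum>c<k. f u c) \<noteq> 0"
  shows "Z a S q = factor a S q v i e (f (oth e v)) * Z a S (q(v := Suc e))"
proof (cases "\<not> inc e v \<or> e < q (oth e v)")
  case True
  then show ?thesis
    unfolding Z_def factor_def by (simp add: weight_skip[of q v e, OF q True])
next
  case False
  let ?u = "oth e v" and ?q = "q(v := Suc e)"
  have u: "?u < n" "?u \<noteq> v" and qu: "q ?u \<le> e" and inc: "inc e v"
    using False e oth_less oth_neq by auto
  have "\<phi> v = i" if "\<phi> \<in> colourings S" for \<phi>
    using colouring_pinned[OF that v] S(2) by simp
  then have Zq: "Z a S q = (\<Sum>\<phi>\<in>colourings S. a i (\<phi> ?u) * weight a ?q \<phi>)"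
    unfolding Z_def using weight_step[OF e q qu inc sym] by (intro sum.cong) auto
  show ?thesis
  proof (cases "S ?u = 0")
    case S0: False
    then have "Z a S q = (\<Sum>\<phi>\<in>colourings S. a i (S ?u - 1) * weight a ?q \<phi>)"
      unfolding Zq using colouring_pinned[OF _ u(1)] by (intro sum.cong) auto
    then show ?thesis
      using False S0 by (simp add: factor_def Z_def sum_distrib_left)
  next
    case S0: True
    \<comment> \<open>With its edges deleted, the colour of \<open>?u\<close> no longer matters, so
      \<open>?Y\<close> is common to all \<open>c\<close> and cancels from the average.\<close>
    let ?Y = "Z a (S(?u := Suc 0)) (?q(?u := M))"
    have Zc: "Z a (S(?u := Suc c)) ?q = f ?u c * ?Y" if "c < k" for c
    proof -
      have "Z a (S(?u := Suc c)) (?q(?u := M)) = ?Y"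
        using u S0 that k_ge_1 by (intro Z_pinned_isolated) auto
      then show ?thesis
        using f[OF u(1) S0 _ that] qu e by simp
    qed
    have "Z a S q = (\<Sum>c<k. \<Sum>\<phi> | \<phi> \<in> colourings S \<and> \<phi> ?u = c. a i (\<phi> ?u) * weight a ?q \<phi>)"
      unfolding Zq using u finite_colourings colouring_less
      by (intro sum.group[symmetric]) auto
    also have "\<dots> = (\<Sum>c<k. a i c * Z a (S(?u := Suc c)) ?q)"
      unfolding Z_def colourings_upd[of ?u S, OF u(1) S0] sum_distrib_left by (intro sum.cong) auto
    also have "\<dots> = (\<Sum>c<k. a i c * f ?u c) * ?Y"
      unfolding sum_distrib_right using Zc by (intro sum.cong) auto
    finally have 1: "Z a S q = (\<Sum>c<k. a i c * f ?u c) * ?Y" .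
    have "Z a S ?q = (\<Sum>c<k. Z a (S(?u := Suc c)) ?q)"
      by (rule Z_split[OF u(1)]) (rule S0)
    also have "\<dots> = (\<Sum>c<k. f ?u c) * ?Y"
      unfolding sum_distrib_right using Zc by (intro sum.cong) auto
    finally show ?thesis
      using 1 nz[OF u(1)] False S0 by (simp add: factor_def average_def)
  qed
qed

text \<open>Every level pins one more vertex, so in a tree at least as deep as the number of free
  vertices no truncated value is ever used.\<close>

lemma Z_eq_W:
  assumes a: "close_to_one D k a" and sym: "\<forall>i<k. \<forall>j<k. a i j = a j i"
    and "\<And>u. S u \<le> k" "v < n" "S v = 0" "q v \<le> M" "i < k" "card {w. w < n \<and> S w = 0} \<le> d"
  shows "Z a (S(v := Suc i)) q = W a d S q v i * Z a (S(v := Suc i)) (q(v := M))"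
  using assms(3-)
proof (induction d arbitrary: S q v i)
  case 0
  then have "{w. w < n \<and> S w = 0} = {}" by simp
  with 0 show ?case by blast
next
  case (Suc d)
  let ?S = "S(v := Suc i)"
  let ?F = "\<lambda>e. factor a S q v i e (W a d ?S (q(v := Suc e)) (oth e v))"
  have S: "\<And>u. ?S u \<le> k"
    using Suc.prems by auto
  have "{w. w < n \<and> ?S w = 0} \<subset> {w. w < n \<and> S w = 0}"
    using Suc.prems by auto
  from psubset_card_mono[OF _ this] have card: "card {w. w < n \<and> ?S w = 0} \<le> d"
    using Suc.prems(6) by simp
  have step_fact: "Z a ?S (q(v := e)) = ?F e * Z a ?S (q(v := Suc e))" if e: "e < M" for e
  proof -
    have "Z a ?S (q(v := e)) =
      factor a ?S (q(v := e)) v i e (W a d ?S (q(v := Suc e)) (oth e v)) * Z a ?S ((q(v := e))(v := Suc e))"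
    proof (rule Z_factor[where f = "W a d ?S (q(v := Suc e))", OF a sym S])
      fix u c assume u: "u < n" "?S u = 0" "(q(v := e)) u \<le> M" "c < k"
      then have "(q(v := Suc e)) u \<le> M"
        by (cases "u = v") auto
      from Suc.IH[of ?S u "q(v := Suc e)" c, OF S u(1,2) this u(4) card]
      show "Z a (?S(u := Suc c)) ((q(v := e))(v := Suc e)) =
        W a d ?S (q(v := Suc e)) u c * Z a (?S(u := Suc c)) ((q(v := e))(v := Suc e, u := M))"
        by (simp only: fun_upd_upd)
    next
      show "(\<Sum>c<k. W a d ?S (q(v := Suc e)) u c) \<noteq> 0" if "u < n" for u
        by (rule W_sum_nonzero[OF a S that])
    qed (use Suc.prems e in auto)
    \<comment> \<open>\<open>factor\<close> reads \<open>S\<close> and \<open>q\<close> only at the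
      other end, so pinning \<open>v\<close> and moving its pointer are invisible to it.\<close>
    moreover have "factor a ?S (q(v := e)) v i e g = factor a S q v i e g" for g
      using oth_neq[OF e] by (auto simp: factor_def)
    ultimately show ?thesis by simp
  qed
  \<comment> \<open>The one-edge identities telescope, from the pointer value \<open>M\<close>
    downwards.\<close>
  have "Z a ?S (q(v := p)) = (\<Prod>e\<in>{p..<M}. ?F e) * Z a ?S (q(v := M))" if "p \<le> M" for p
    using that
  proof (induction p rule: inc_induct)
    case (step e)
    then have "{e..<M} = insert e {Suc e..<M}" by auto
    then have "(\<Prod>e\<in>{e..<M}. ?F e) = ?F e * (\<Prod>e\<in>{Suc e..<M}. ?F e)"
      by (simp only:) (rule prod.insert, auto)
    then show ?case
      by (simp only: step_fact[OF \<open>e < M\<close>] step.IH mult.assoc)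
  qed simp
  from this[OF \<open>q v \<le> M\<close>] show ?case
    by (simp only: fun_upd_triv W.simps)
qed

end

section \<open>Truncation of the computation tree\<close>

context bounded_graph
begin

definition root_pointers :: "nat \<Rightarrow> nat \<Rightarrow> nat" where
  "root_pointers r = (\<lambda>w. if w < r then M else 0)"

text \<open>\<open>Y a d r / k\<close> approximates the ratio of the partition functions before and
  after the deletion of all edges at \<open>r\<close>, while \<open>r\<close> itself stays
  free.\<close>

definition Y :: "(nat \<Rightarrow> nat \<Rightarrow> complex) \<Rightarrow> nat \<Rightarrow> nat \<Rightarrow> complex" where
  "Y a d r = (\<Sum>i<k. W a d (\<lambda>_. 0) (root_pointers r) r i)"

text \<open>Vertices below \<open>r\<close> have lost all their edges but stay free, so each contributes a factor \<open>k\<close>.\<close>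

lemma Z_root:
  assumes a: "close_to_one D k a" and sym: "\<forall>i<k. \<forall>j<k. a i j = a j i"
    and r: "r < n" and d: "n \<le> d"
  shows "of_nat k * Z a (\<lambda>_. 0) (root_pointers r) =
    Y a d r * Z a (\<lambda>_. 0) (root_pointers (Suc r))"
proof -
  let ?q = "root_pointers (Suc r)"
  have q: "(root_pointers r)(r := M) = ?q"
    by (auto simp: root_pointers_def)
  have iso: "Z a (\<lambda>_. 0) ?q = of_nat k * Z a ((\<lambda>_. 0)(r := Suc i)) ?q" if "i < k" for i
    using r that by (intro Z_isolated) (auto simp: root_pointers_def)
  have "Z a (\<lambda>_. 0) (root_pointers r) = (\<Sum>i<k. Z a ((\<lambda>_. 0)(r := Suc i)) (root_pointers r))"
    using r by (intro Z_split) auto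
  also have "\<dots> = (\<Sum>i<k. W a d (\<lambda>_. 0) (root_pointers r) r i * Z a ((\<lambda>_. 0)(r := Suc i)) ?q)"
    unfolding q[symmetric] using r d
    by (intro sum.cong Z_eq_W[OF a sym]) (auto simp: root_pointers_def)
  \<comment> \<open>The factor \<open>k\<close> lets \<open>iso\<close> replace each pinned
    partition function by the same unpinned one.\<close>
  finally have "of_nat k * Z a (\<lambda>_. 0) (root_pointers r) =
      (\<Sum>i<k. W a d (\<lambda>_. 0) (root_pointers r) r i * (of_nat k * Z a ((\<lambda>_. 0)(r := Suc i)) ?q))"
    by (simp add: sum_distrib_left mult.left_commute)
  also have "\<dots> = Y a d r * Z a (\<lambda>_. 0) ?q"
    unfolding Y_def sum_distrib_right by (intro sum.cong) (auto simp: iso)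
  finally show ?thesis .
qed

text \<open>\<open>Z_root\<close> telescopes as the vertices are isolated in turn. In the end no
  edge is left, the partition function is \<open>k ^ n\<close>, and the powers of \<open>k\<close>
  cancel.\<close>

lemma Z_unpinned_eq_prod:
  assumes a: "close_to_one D k a" and sym: "\<forall>i<k. \<forall>j<k. a i j = a j i" and d: "n \<le> d"
  shows "Z a (\<lambda>_. 0) (\<lambda>_. 0) = (\<Prod>r<n. Y a d r)"
proof -
  have "of_nat k ^ m * Z a (\<lambda>_. 0) (\<lambda>_. 0) = (\<Prod>r<m. Y a d r) * Z a (\<lambda>_. 0) (root_pointers m)"
    if "m \<le> n" for m
    using that
  proof (induction m)
    case 0
    have "root_pointers 0 = (\<lambda>_. 0)" by (auto simp: root_pointers_def)
    then show ?case by simp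
  next
    case (Suc m)
    then show ?case
      using Z_root[OF a sym, of m d] d by (simp add: mult.assoc mult.left_commute)
  qed
  moreover have "Z a (\<lambda>_. 0) (root_pointers n) = of_nat k ^ n"
  proof -
    have "colourings (\<lambda>_. 0) = {..<n} \<rightarrow>\<^sub>E {..<k}"
      by (auto simp: colourings_def)
    moreover have "weight a (root_pointers n) \<phi> = 1" for \<phi>
      unfolding weight_def root_pointers_def using ends by (intro prod.neutral) auto
    ultimately show ?thesis
      by (simp add: Z_def card_PiE)
  qed
  ultimately show ?thesis
    using k_ge_1 by (metis (no_types, lifting) mult.commute mult_cancel_left not_one_le_zero of_nat_eq_0_iff order_refl power_not_zero)
qed

text \<open>Along the segment from the all-ones matrix to \<open>a\<close>, every level of the recursion contributes one
  more factor \<open>z\<close> to the difference of two truncations.\<close>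

definition line :: "(nat \<Rightarrow> nat \<Rightarrow> complex) \<Rightarrow> complex \<Rightarrow> nat \<Rightarrow> nat \<Rightarrow> complex" where
  "line a z = (\<lambda>i j. 1 + z * (a i j - 1))"

text \<open>26/25 * 17/50 = 221/625: the radius of the disc uses up exactly the slack in
  \<open>close_to_one\<close>.\<close>

lemma close_to_one_line:
  assumes a: "\<forall>i<k. \<forall>j<k. norm (a i j - 1) \<le> 17/50 / real D" and z: "norm z \<le> 26/25"
  shows "close_to_one D k (line a z)"
  unfolding close_to_one_def
proof (intro allI impI)
  fix i j assume "i < k" "j < k"
  then have "norm z * norm (a i j - 1) \<le> 26/25 * (17/50 / real D)"
    using a z by (intro mult_mono) auto
  then show "norm (line a z i j - 1) \<le> 221 / 625 / real D"
    by (simp add: line_def norm_mult)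
qed

text \<open>The normalisation splits off the constant 1 and an explicit factor \<open>z\<close>, the
  shape that \<open>agree_one_plus\<close> requires.\<close>

lemma average_line:
  assumes "(\<Sum>c<k. f c) \<noteq> 0"
  shows "average k (line a z) i f = 1 + z * ((\<Sum>c<k. (a i c - 1) * f c) / (\<Sum>c<k. f c))"
proof -
  have "(\<Sum>c<k. line a z i c * f c) = (\<Sum>c<k. f c) + z * (\<Sum>c<k. (a i c - 1) * f c)"
    by (simp add: line_def sum_distrib_left sum.distrib[symmetric] algebra_simps)
  then show ?thesis
    using assms by (simp add: average_def add_divide_distrib)
qed

lemma agree_factor:
  fixes m :: nat
  assumes nz: "\<And>z. z \<in> ball 0 R \<Longrightarrow> (\<Sum>c<k. f z c) \<noteq> 0" "\<And>z. z \<in> ball 0 R \<Longrightarrow> (\<Sum>c<k. g z c) \<noteq> 0"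
    and fg: "\<And>c. c < k \<Longrightarrow> agree R m (\<lambda>z. f z c) (\<lambda>z. g z c)"
  shows "agree R (Suc m) (\<lambda>z. factor (line a z) S q v i e (f z)) (\<lambda>z. factor (line a z) S q v i e (g z))"
proof -
  consider "\<not> inc e v \<or> e < q (oth e v)" | "inc e v" "\<not> e < q (oth e v)" "S (oth e v) \<noteq> 0"
    | "inc e v" "\<not> e < q (oth e v)" "S (oth e v) = 0"
    by blast
  then show ?thesis
  proof cases
    case 1
    then show ?thesis by (auto simp: factor_def intro!: agree_refl)
  next
    case 2
    then show ?thesis
      by (auto simp: factor_def line_def intro!: agree_refl holomorphic_intros)
  next
    case 3
    have "agree R (Suc m) (\<lambda>z. 1 + z * ((\<Sum>c<k. (a i c - 1) * f z c) / (\<Sum>c<k. f z c)))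
      (\<lambda>z. 1 + z * ((\<Sum>c<k. (a i c - 1) * g z c) / (\<Sum>c<k. g z c)))"
      using nz by (intro agree_one_plus agree_divide agree_sum agree_mult agree_refl fg) auto
    then have "agree R (Suc m) (\<lambda>z. average k (line a z) i (f z)) (\<lambda>z. average k (line a z) i (g z))"
      by (rule agree_cong) (simp_all add: average_line nz)
    then show ?thesis using 3 by (simp add: factor_def)
  qed
qed

lemma holomorphic_W:
  assumes a: "\<forall>i<k. \<forall>j<k. norm (a i j - 1) \<le> 17/50 / real D"
    and "\<And>u. S u \<le> k" "v < n" "i < k"
  shows "(\<lambda>z. W (line a z) d S q v i) holomorphic_on ball 0 (26/25)"
  using assms(2-)
proof (induction d arbitrary: S q v i)
  case 0
  show ?case by simp
next
  case (Suc d)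
  let ?S = "S(v := Suc i)"
  have S: "?S u \<le> k" for u
    using Suc.prems by auto
  let ?f = "\<lambda>e z. factor (line a z) S q v i e (W (line a z) d ?S (q(v := Suc e)) (oth e v))"
  have "?f e holomorphic_on ball 0 (26/25)" if e: "e < M" for e
  proof (cases "inc e v")
    case False
    then show ?thesis by (simp add: factor_def)
  next
    case True
    have nz: "(\<Sum>c<k. W (line a z) d' ?S q' (oth e v) c) \<noteq> 0" if "z \<in> ball 0 (26/25)" for z d' q'
      using that by (intro W_sum_nonzero[where S = ?S, OF _ S oth_less[OF e True]] close_to_one_line a) auto
    \<comment> \<open>\<open>agree\<close> includes holomorphy, so comparing the function with
      itself reuses the case analysis of \<open>agree_factor\<close>.\<close>
    have "agree (26/25) (Suc 0) (?f e) (?f e)"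
    proof (rule agree_factor)
      fix c assume "c < k"
      then show "agree (26/25) 0 (\<lambda>z. W (line a z) d ?S (q(v := Suc e)) (oth e v) c)
        (\<lambda>z. W (line a z) d ?S (q(v := Suc e)) (oth e v) c)"
        using S oth_less[OF e True] by (intro agree_zero Suc.IH) auto
    qed (rule nz, assumption)+
    then show ?thesis by (simp add: agree_def)
  qed
  then show ?case
    by (auto intro!: holomorphic_intros)
qed

text \<open>Once \<open>d + j\<close> reaches the number of vertices the deeper tree is exact, so
  the comparison measures the truncation.\<close>

lemma agree_W:
  assumes a: "\<forall>i<k. \<forall>j<k. norm (a i j - 1) \<le> 17/50 / real D"
    and "\<And>u. S u \<le> k" "v < n" "i < k"
  shows "agree (26/25) d (\<lambda>z. W (line a z) d S q v i) (\<lambda>z. W (line a z) (d + j) S q v i)"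
  using assms(2-)
proof (induction d arbitrary: S q v i)
  case 0
  then show ?case by (intro agree_zero holomorphic_W[OF a])
next
  case (Suc d)
  let ?S = "S(v := Suc i)"
  have S: "?S u \<le> k" for u
    using Suc.prems by auto
  let ?f = "\<lambda>d e z. factor (line a z) S q v i e (W (line a z) d ?S (q(v := Suc e)) (oth e v))"
  have "agree (26/25) (Suc d) (?f d e) (?f (d + j) e)" if e: "e < M" for e
  proof (cases "inc e v")
    case False
    then show ?thesis by (simp add: factor_def agree_refl)
  next
    case True
    have nz: "(\<Sum>c<k. W (line a z) d' ?S q' (oth e v) c) \<noteq> 0" if "z \<in> ball 0 (26/25)" for z d' q'
      using that by (intro W_sum_nonzero[where S = ?S, OF _ S oth_less[OF e True]] close_to_one_line a) auto
    show ?thesis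
    proof (rule agree_factor)
      fix c assume "c < k"
      then show "agree (26/25) d (\<lambda>z. W (line a z) d ?S (q(v := Suc e)) (oth e v) c)
        (\<lambda>z. W (line a z) (d + j) ?S (q(v := Suc e)) (oth e v) c)"
        using S oth_less[OF e True] by (intro Suc.IH) auto
    qed (rule nz, assumption)+
  qed
  then have "agree (26/25) (Suc d) (\<lambda>z. \<Prod>e\<in>{q v..<M}. ?f d e z) (\<lambda>z. \<Prod>e\<in>{q v..<M}. ?f (d + j) e z)"
    by (intro agree_prod) auto
  then show ?case by simp
qed

text \<open>Both trees are bounded by 2 on the disc, whence 4; 103/100 is a radius strictly between
  1 and 26/25.\<close>

lemma W_error:
  assumes a: "\<forall>i<k. \<forall>j<k. norm (a i j - 1) \<le> 17/50 / real D"
    and S: "\<And>u. S u \<le> k" "v < n" "i < k"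
  shows "norm (W a d S q v i - W a (d + j) S q v i) \<le> 4 / (103/100) ^ d"
proof -
  have b: "norm (W (line a z) d S q v i) \<le> 2" if "z \<in> ball 0 (26/25)" for z d
  proof -
    have "close_to_one D k (line a z)"
      using that by (intro close_to_one_line a) auto
    from W_exp[where S = S, OF this S(1,2)] have "\<exists>g. W (line a z) d S q v c = exp g \<and> norm g \<le> 3 / 5" if "c < k" for c
      using that by blast
    from sum_exp_lower(2)[of k "W (line a z) d S q v", OF this S(3)] show ?thesis by blast
  qed
  have "line a 1 = a" by (simp add: line_def)
  moreover have "norm (W (line a 1) d S q v i - W (line a 1) (d + j) S q v i) \<le> 4 / (103/100) ^ d"
  proof (rule agree_diff_le[OF agree_W[OF a S]])
    fix z :: complex assume "z \<in> ball 0 (26/25)"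
    then show "norm (W (line a z) d S q v i - W (line a z) (d + j) S q v i) \<le> 4"
      using b[of z d] b[of z "d + j"] norm_triangle_ineq4[of "W (line a z) d S q v i" "W (line a z) (d + j) S q v i"]
      by linarith
  qed auto
  ultimately show ?thesis by simp
qed

text \<open>The error summed over the colours is at most \<open>k * \<epsilon> / (5 * n)\<close>,
  and the deeper sum is at least \<open>41/100 * k\<close>. The relative error is thus at most
  \<open>20/41 * \<epsilon> / n\<close>, below 1/2, and its logarithm at most doubles it. This is
  what the constant 20 is for.\<close>

lemma Y_ratio:
  assumes a: "\<forall>i<k. \<forall>j<k. norm (a i j - 1) \<le> 17/50 / real D" and r: "r < n"
    and eps: "0 < \<epsilon>" "\<epsilon> \<le> 1" "20 * real n / \<epsilon> \<le> (103/100) ^ d"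
  shows "Y a (d + j) r \<noteq> 0" "\<exists>l. Y a d r = Y a (d + j) r * exp l \<and> norm l \<le> \<epsilon> / real n"
proof -
  have "close_to_one D k (line a 1)"
    by (intro close_to_one_line a) simp
  then have cl: "close_to_one D k a" by (simp add: line_def)
  have low: "41/100 * real k \<le> norm (Y a (d + j) r)"
    unfolding Y_def using W_exp[OF cl _ r] by (intro sum_exp_norm_ge) auto
  then show nz: "Y a (d + j) r \<noteq> 0"
    using k_ge_1 by auto
  let ?h = "(Y a d r - Y a (d + j) r) / Y a (d + j) r"
  have n: "0 < real n" using r by simp
  have "norm (Y a d r - Y a (d + j) r) \<le> (\<Sum>i<k. 4 / (103/100) ^ d)"
    unfolding Y_def sum_subtractf[symmetric] using r
    by (intro sum_norm_le W_error[OF a]) auto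
  also have "\<dots> = real k * 4 / (103/100) ^ d" by simp
  also have "\<dots> \<le> real k * 4 / (20 * real n / \<epsilon>)"
    using eps n by (intro divide_left_mono) auto
  also have "\<dots> = 1/5 * real k * (\<epsilon> / real n)"
    using n eps by (simp add: field_simps)
  also have "\<dots> \<le> 41/100 * real k * (20/41 * \<epsilon> / real n) "
    using n eps by (simp add: field_simps)
  also have "\<dots> \<le> norm (Y a (d + j) r) * (20/41 * \<epsilon> / real n)"
    using low n eps by (intro mult_right_mono) auto
  finally have "norm (Y a d r - Y a (d + j) r) \<le> norm (Y a (d + j) r) * (20/41 * \<epsilon> / real n)" .
  then have h: "norm ?h \<le> 20/41 * \<epsilon> / real n"
    using nz by (simp add: norm_divide divide_le_eq mult.commute)
  have "\<epsilon> / real n \<le> 1"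
    using eps n r by (simp add: divide_le_eq)
  then have half: "norm ?h < 1 / 2"
    using h by simp
  have "norm (Ln (1 + ?h)) \<le> 2 * norm ?h"
    by (rule norm_Ln_le[OF half])
  also have "\<dots> \<le> \<epsilon> / real n"
    using h n eps by (simp add: field_simps)
  finally have "norm (Ln (1 + ?h)) \<le> \<epsilon> / real n" .
  moreover have "1 + ?h \<noteq> 0"
    using half by (metis add_eq_0_iff norm_minus_cancel norm_one less_divide_eq_1 not_less_iff_gr_or_eq one_less_numeral_iff semiring_norm(76) zero_less_numeral)
  then have "Y a d r = Y a (d + j) r * exp (Ln (1 + ?h))"
    using nz by (simp add: field_simps)
  ultimately show "\<exists>l. Y a d r = Y a (d + j) r * exp l \<and> norm l \<le> \<epsilon> / real n"
    by blast
qed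

text \<open>Depth \<open>d + n\<close> is exact, and the \<open>n\<close> logarithmic errors of size
  \<open>\<epsilon> / n\<close> add up to \<open>\<epsilon>\<close>.\<close>

lemma prod_Y_ratio:
  assumes a: "\<forall>i<k. \<forall>j<k. norm (a i j - 1) \<le> 17/50 / real D"
    and sym: "\<forall>i<k. \<forall>j<k. a i j = a j i"
    and eps: "0 < \<epsilon>" "\<epsilon> \<le> 1" "20 * real n / \<epsilon> \<le> (103/100) ^ d"
  shows "Z a (\<lambda>_. 0) (\<lambda>_. 0) \<noteq> 0"
    "\<exists>l. (\<Prod>r<n. Y a d r) = Z a (\<lambda>_. 0) (\<lambda>_. 0) * exp l \<and> norm l \<le> \<epsilon>"
proof -
  have "close_to_one D k (line a 1)"
    by (intro close_to_one_line a) simp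
  then have cl: "close_to_one D k a" by (simp add: line_def)
  have Z: "Z a (\<lambda>_. 0) (\<lambda>_. 0) = (\<Prod>r<n. Y a (d + n) r)"
    by (rule Z_unpinned_eq_prod[OF cl sym]) simp
  note ratio = Y_ratio[OF a _ eps, where j = n]
  show "Z a (\<lambda>_. 0) (\<lambda>_. 0) \<noteq> 0"
    unfolding Z using ratio(1) by simp
  obtain l where l: "\<And>r. r < n \<Longrightarrow> Y a d r = Y a (d + n) r * exp (l r) \<and> norm (l r) \<le> \<epsilon> / real n"
    using ratio(2) by metis
  have "(\<Prod>r<n. Y a d r) = (\<Prod>r<n. Y a (d + n) r) * exp (\<Sum>r<n. l r)"
    using l by (simp add: exp_sum prod.distrib[symmetric])
  moreover have "norm (\<Sum>r<n. l r) \<le> (\<Sum>r<n. \<epsilon> / real n)"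
    using l by (intro sum_norm_le) auto
  then have "norm (\<Sum>r<n. l r) \<le> \<epsilon>"
    using eps by (cases "n = 0") auto
  ultimately show "\<exists>l. (\<Prod>r<n. Y a d r) = Z a (\<lambda>_. 0) (\<lambda>_. 0) * exp l \<and> norm l \<le> \<epsilon>"
    unfolding Z by blast
qed

end

section \<open>The program\<close>

fun loop_free :: "com \<Rightarrow> bool" where
  "loop_free (Seq c d) \<longleftrightarrow> loop_free c \<and> loop_free d"
| "loop_free (Cond b c d) \<longleftrightarrow> loop_free c \<and> loop_free d"
| "loop_free (While b c) \<longleftrightarrow> False"
| "loop_free _ \<longleftrightarrow> True"

fun run :: "com \<Rightarrow> state \<Rightarrow> state" where
  "run Skip s = s"
| "run (NAssign x i a) s = nstore x (nval i s) (nval a s) s"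
| "run (CAssign x i a) s = cstore x (nval i s) (cval a s) s"
| "run (Seq c d) s = run d (run c s)"
| "run (Cond b c d) s = (if tval b s then run c s else run d s)"
| "run (While b c) s = s"

text \<open>Both branches of a conditional are charged, which makes the bound independent of the
  state. The values at \<open>While\<close>, here and in \<open>run\<close>, are dummies.\<close>

fun run_cost :: "com \<Rightarrow> nat" where
  "run_cost Skip = 1"
| "run_cost (NAssign x i a) = 1 + ncost i + ncost a"
| "run_cost (CAssign x i a) = 1 + ncost i + ccost a"
| "run_cost (Seq c d) = run_cost c + run_cost d"
| "run_cost (Cond b c d) = 1 + tcost b + run_cost c + run_cost d"
| "run_cost (While b c) = 0"

lemma exec_run: "loop_free c \<Longrightarrow> \<exists>t\<le>run_cost c. exec c s t (run c s)"
proof (induction c arbitrary: s)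
  case (Seq c d)
  then obtain t t' where "t \<le> run_cost c" "exec c s t (run c s)"
    "t' \<le> run_cost d" "exec d (run c s) t' (run d (run c s))"
    by (metis loop_free.simps(1))
  then show ?case
    by (intro exI[of _ "t + t'"]) (auto intro: exec.Seq)
next
  case (Cond b c d)
  then obtain t t' where "t \<le> run_cost c" "exec c s t (run c s)"
    "t' \<le> run_cost d" "exec d s t' (run d s)"
    by (metis loop_free.simps(2))
  then have c: "exec c s t (run c s)" "t \<le> run_cost c" and d: "exec d s t' (run d s)" "t' \<le> run_cost d"
    by auto
  show ?case
  proof (cases "tval b s")
    case True
    then show ?thesis
      using exec.CondTrue[OF True c(1)] c(2) by (intro exI[of _ "1 + tcost b + t"]) auto
  next
    case False
    then show ?thesis
      using exec.CondFalse[OF False d(1)] d(2) by (intro exI[of _ "1 + tcost b + t'"]) auto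
  qed
next
  case Skip
  show ?case using exec.Skip by auto
next
  case (NAssign a i e)
  show ?case using exec.NAssign[of a i e s] by auto
next
  case (CAssign a i e)
  show ?case using exec.CAssign[of a i e s] by auto
qed auto

fun iterates :: "test \<Rightarrow> com \<Rightarrow> nat \<Rightarrow> state \<Rightarrow> state \<Rightarrow> bool" where
  "iterates b c 0 s s' \<longleftrightarrow> s = s'"
| "iterates b c (Suc j) s s' \<longleftrightarrow> tval b s \<and> iterates b c j (run c s) s'"

text \<open>Each round of a loop-free body has bounded cost, so only rounds must be counted. The
  extra one in \<open>Suc j\<close> pays for the failing test.\<close>

lemma exec_While:
  assumes c: "loop_free c" and "iterates b c j s s'" "\<not> tval b s'"
  shows "\<exists>t\<le>Suc j * (1 + tcost b + run_cost c). exec (While b c) s t s'"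
  using assms(2,3)
proof (induction j arbitrary: s)
  case 0
  then show ?case
    by (intro exI[of _ "1 + tcost b"]) (auto intro: exec.WhileFalse[simplified])
next
  case (Suc j)
  then obtain t where t: "t \<le> Suc j * (1 + tcost b + run_cost c)" "exec (While b c) (run c s) t s'"
    by auto
  obtain u where u: "u \<le> run_cost c" "exec c s u (run c s)"
    using exec_run[OF c] by blast
  have "exec (While b c) s (1 + tcost b + u + t) s'"
    using Suc.prems u t by (intro exec.WhileTrue) auto
  moreover have "1 + tcost b + u + t \<le> Suc (Suc j) * (1 + tcost b + run_cost c)"
    using u t by simp
  ultimately show ?case by blast
qed

section \<open>The code of the traversal\<close>

abbreviation scalar :: "name \<Rightarrow> nexp" where
  "scalar a \<equiv> NCell a (NConst 0)"

text \<open>The machine cannot multiply natural numbers; since \<open>k\<close> is fixed, repeated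
  addition is written out in the code at constant cost.\<close>

fun nmul :: "nat \<Rightarrow> nexp \<Rightarrow> nexp" where
  "nmul 0 a = NConst 0"
| "nmul (Suc j) a = NAdd a (nmul j a)"

fun csum :: "nat \<Rightarrow> (nat \<Rightarrow> cexp) \<Rightarrow> cexp" where
  "csum 0 f = COfNat (NConst 0)"
| "csum (Suc j) f = CAdd (csum j f) (f j)"

definition test_or :: "test \<Rightarrow> test \<Rightarrow> test" where
  "test_or a b = TNot (TAnd (TNot a) (TNot b))"

definition nequal :: "nexp \<Rightarrow> nexp \<Rightarrow> test" where
  "nequal a b = TAnd (TNot (NLess a b)) (TNot (NLess b a))"

lemma nval_nmul [simp]: "nval (nmul j a) s = j * nval a s"
  by (induction j) auto

lemma cval_csum [simp]: "cval (csum j f) s = (\<Sum>c<j. cval (f c) s)"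
  by (induction j) auto

lemma tval_test_or [simp]: "tval (test_or a b) s \<longleftrightarrow> tval a s \<or> tval b s"
  by (auto simp: test_or_def)

lemma tval_nequal [simp]: "tval (nequal a b) s \<longleftrightarrow> nval a s = nval b s"
  by (auto simp: nequal_def)

text \<open>The entries of the vector of a vertex \<open>v\<close> are stored at \<open>k * v + 1, \<dots>, k * v + k\<close>: the colour
  \<open>i\<close> is represented by \<open>i + 1\<close>, as \<open>0\<close> marks a free vertex.\<close>

definition vec_index :: "nat \<Rightarrow> nexp \<Rightarrow> nexp \<Rightarrow> nexp" where
  "vec_index k v p = NAdd (nmul k v) p"

text \<open>Both arguments are colours plus one:
  \<open>k * (i + 1) + (j + 1) - (k + 1) = k * i + j\<close>, the row-major position.\<close>

definition mat_index :: "nat \<Rightarrow> nexp \<Rightarrow> nexp \<Rightarrow> nexp" where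
  "mat_index k p p' = NSub (NAdd (nmul k p) p') (NConst (Suc k))"

lemma nval_vec_index [simp]: "nval (vec_index k v p) s = k * nval v s + nval p s"
  by (simp add: vec_index_def)

lemma nval_mat_index [simp]: "nval (mat_index k p p') s = k * nval p s + nval p' s - Suc k"
  by (simp add: mat_index_def)

fun set_ones :: "nat \<Rightarrow> nexp \<Rightarrow> nat \<Rightarrow> com" where
  "set_ones k v 0 = Skip"
| "set_ones k v (Suc j) =
     Seq (set_ones k v j) (CAssign ''vec'' (vec_index k v (NConst (Suc j))) (COfNat (NConst 1)))"

definition scale_vec :: "nat \<Rightarrow> cexp \<Rightarrow> com" where
  "scale_vec k z = CAssign ''vec'' (vec_index k (scalar ''cur'') (NCell ''pin'' (scalar ''cur'')))
     (CMul (CCell ''vec'' (vec_index k (scalar ''cur'') (NCell ''pin'' (scalar ''cur'')))) z)"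

definition vec_sum :: "nat \<Rightarrow> nexp \<Rightarrow> cexp" where
  "vec_sum k u = csum k (\<lambda>c. CCell ''vec'' (vec_index k u (NConst (Suc c))))"

text \<open>At the depth limit the new frame is born complete with the vector of ones, which is the
  value of \<open>W\<close> at depth 0.\<close>

definition push :: "nat \<Rightarrow> com" where
  "push k =
     Seq (set_ones k (scalar ''oth'') k)
    (Seq (NAssign ''par'' (scalar ''oth'') (scalar ''cur''))
    (Seq (Cond (NLess (scalar ''dep'') (scalar ''max''))
           (NAssign ''pin'' (scalar ''oth'') (NConst 1))
           (NAssign ''pin'' (scalar ''oth'') (NConst (Suc k))))
    (Seq (NAssign ''dep'' (NConst 0) (NAdd (scalar ''dep'') (NConst 1)))
         (NAssign ''cur'' (NConst 0) (scalar ''oth'')))))"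

text \<open>The pointer advances before the edge is processed, so a child already sees the
  configuration without this edge.\<close>

definition scan :: "nat \<Rightarrow> com" where
  "scan k =
     Seq (NAssign ''edge'' (NConst 0) (NCell ''ptr'' (scalar ''cur'')))
    (Seq (NAssign ''ptr'' (scalar ''cur'') (NAdd (scalar ''edge'') (NConst 1)))
    (Cond (test_or (nequal (NCell ''end1'' (scalar ''edge'')) (scalar ''cur''))
                   (nequal (NCell ''end2'' (scalar ''edge'')) (scalar ''cur'')))
      (Seq (NAssign ''oth'' (NConst 0)
             (NSub (NAdd (NCell ''end1'' (scalar ''edge'')) (NCell ''end2'' (scalar ''edge''))) (scalar ''cur'')))
        (Cond (NLess (scalar ''edge'') (NCell ''ptr'' (scalar ''oth'')))
          Skip
          (Cond (NLess (NConst 0) (NCell ''pin'' (scalar ''oth'')))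
            (scale_vec k (CCell ''matrix''
               (mat_index k (NCell ''pin'' (scalar ''cur'')) (NCell ''pin'' (scalar ''oth'')))))
            (push k))))
      Skip))"

definition next_colour :: com where
  "next_colour =
     Seq (NAssign ''ptr'' (scalar ''cur'') (NConst 0))
         (NAssign ''pin'' (scalar ''cur'') (NAdd (NCell ''pin'' (scalar ''cur'')) (NConst 1)))"

definition pop :: "nat \<Rightarrow> com" where
  "pop k =
     Seq (NAssign ''oth'' (NConst 0) (scalar ''cur''))
    (Seq (NAssign ''cur'' (NConst 0) (NCell ''par'' (scalar ''oth'')))
    (Seq (NAssign ''pin'' (scalar ''oth'') (NConst 0))
    (Seq (NAssign ''dep'' (NConst 0) (NSub (scalar ''dep'') (NConst 1)))
         (scale_vec k (CDiv
           (csum k (\<lambda>c. CMul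
             (CCell ''matrix'' (mat_index k (NCell ''pin'' (scalar ''cur'')) (NConst (Suc c))))
             (CCell ''vec'' (vec_index k (scalar ''oth'') (NConst (Suc c))))))
           (vec_sum k (scalar ''oth'')))))))"

text \<open>Moving the pointer to the end deletes all edges at the old root. After the last root
  this initialises the nonexistent vertex \<open>n\<close>, which is harmless because the loop then
  stops.\<close>

definition next_root :: "nat \<Rightarrow> com" where
  "next_root k =
     Seq (CAssign ''result'' (NConst 0) (CMul (CCell ''result'' (NConst 0)) (vec_sum k (scalar ''cur''))))
    (Seq (NAssign ''pin'' (scalar ''cur'') (NConst 0))
    (Seq (NAssign ''ptr'' (scalar ''cur'') (scalar ''edges''))
    (Seq (NAssign ''root'' (NConst 0) (NAdd (scalar ''root'') (NConst 1)))
    (Seq (NAssign ''cur'' (NConst 0) (scalar ''root''))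
    (Seq (NAssign ''pin'' (scalar ''cur'') (NConst 1))
         (set_ones k (scalar ''cur'') k))))))"

definition body :: "nat \<Rightarrow> com" where
  "body k =
     Cond (NLess (NCell ''pin'' (scalar ''cur'')) (NConst (Suc k)))
       (Cond (NLess (NCell ''ptr'' (scalar ''cur'')) (scalar ''edges'')) (scan k) next_colour)
       (Cond (NLess (NConst 0) (scalar ''dep'')) (pop k) (next_root k))"

lemma loop_free_set_ones: "loop_free (set_ones k v j)"
  by (induction j) auto

lemma loop_free_body: "loop_free (body k)"
  by (simp add: body_def scan_def next_colour_def pop_def next_root_def push_def scale_vec_def
      loop_free_set_ones)

text \<open>The traversal is depth-first. A path in the tree visits each vertex at most once, so the stack
  is kept in arrays indexed by vertices: \<open>par\<close> links to the previous frame, \<open>pin\<close> and \<open>ptr\<close> are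
  the configuration, and \<open>pin \<sigma> v = k + 1\<close> marks a completed frame.\<close>

record machine =
  pin :: "nat \<Rightarrow> nat"
  ptr :: "nat \<Rightarrow> nat"
  par :: "nat \<Rightarrow> nat"
  cur :: nat
  dep :: nat
  root :: nat
  vec :: "nat \<Rightarrow> complex"
  res :: complex

text \<open>The scratch cells for the current edge and its other end are omitted, since every step
  writes them before reading them.\<close>

definition view :: "state \<Rightarrow> machine" where
  "view s = \<lparr> pin = nmem s ''pin'', ptr = nmem s ''ptr'', par = nmem s ''par'',
     cur = nmem s ''cur'' 0, dep = nmem s ''dep'' 0, root = nmem s ''root'' 0,
     vec = cmem s ''vec'', res = cmem s ''result'' 0 \<rparr>"

definition ones_at :: "nat \<Rightarrow> nat \<Rightarrow> nat \<Rightarrow> (nat \<Rightarrow> complex) \<Rightarrow> nat \<Rightarrow> complex" where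
  "ones_at k v j f = (\<lambda>i. if k * v < i \<and> i \<le> k * v + j then 1 else f i)"

lemma ones_at_Suc: "(ones_at k v j f)(Suc (k * v + j) := 1) = ones_at k v (Suc j) f"
  by (auto simp: ones_at_def fun_eq_iff)

lemma run_set_ones:
  assumes "\<And>f. nval v (s\<lparr>cmem := f\<rparr>) = nval v s"
  shows "run (set_ones k v j) s = s\<lparr>cmem := (cmem s)(''vec'' := ones_at k (nval v s) j (cmem s ''vec''))\<rparr>"
proof (induction j)
  case 0
  have "ones_at k (nval v s) 0 f = f" for f
    by (auto simp: ones_at_def fun_eq_iff)
  then show ?case by simp
next
  case (Suc j)
  let ?f = "ones_at k (nval v s) j (cmem s ''vec'')"
  have "run (set_ones k v (Suc j)) s =
      s\<lparr>cmem := (cmem s)(''vec'' := ?f(Suc (k * nval v s + j) := 1))\<rparr>"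
    by (simp only: set_ones.simps run.simps Suc.IH) (simp add: assms cstore_def)
  then show ?case by (simp only: ones_at_Suc)
qed

section \<open>Simulation of the loop body by an abstract step function\<close>

locale tree_machine =
  fixes n M k m :: nat and x y :: "nat \<Rightarrow> nat" and mat :: "nat \<Rightarrow> complex"
begin

definition inputs :: "state \<Rightarrow> bool" where
  "inputs s \<longleftrightarrow> nmem s ''vertices'' 0 = n \<and> nmem s ''edges'' 0 = M \<and> nmem s ''max'' 0 = m \<and>
     nmem s ''end1'' = x \<and> nmem s ''end2'' = y \<and> cmem s ''matrix'' = mat"

definition rescale :: "complex \<Rightarrow> machine \<Rightarrow> machine" where
  "rescale z \<sigma> = (let i = k * cur \<sigma> + pin \<sigma> (cur \<sigma>) in \<sigma>\<lparr>vec := (vec \<sigma>)(i := vec \<sigma> i * z)\<rparr>)"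

definition push_step :: "nat \<Rightarrow> machine \<Rightarrow> machine" where
  "push_step u \<sigma> = \<sigma>\<lparr>vec := ones_at k u k (vec \<sigma>), par := (par \<sigma>)(u := cur \<sigma>),
     pin := (pin \<sigma>)(u := if dep \<sigma> < m then 1 else Suc k), dep := Suc (dep \<sigma>), cur := u\<rparr>"

definition scan_step :: "machine \<Rightarrow> machine" where
  "scan_step \<sigma> = (let v = cur \<sigma>; e = ptr \<sigma> v; \<tau> = \<sigma>\<lparr>ptr := (ptr \<sigma>)(v := Suc e)\<rparr>; u = x e + y e - v in
     if (x e = v \<or> y e = v) \<and> ptr \<tau> u \<le> e
     then if pin \<sigma> u \<noteq> 0 then rescale (mat (k * pin \<sigma> v + pin \<sigma> u - Suc k)) \<tau> else push_step u \<tau>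
     else \<tau>)"

definition next_colour_step :: "machine \<Rightarrow> machine" where
  "next_colour_step \<sigma> = \<sigma>\<lparr>ptr := (ptr \<sigma>)(cur \<sigma> := 0), pin := (pin \<sigma>)(cur \<sigma> := Suc (pin \<sigma> (cur \<sigma>)))\<rparr>"

definition pop_step :: "machine \<Rightarrow> machine" where
  "pop_step \<sigma> = (let u = cur \<sigma>; \<tau> = \<sigma>\<lparr>cur := par \<sigma> u, pin := (pin \<sigma>)(u := 0), dep := dep \<sigma> - 1\<rparr> in
     rescale ((\<Sum>c<k. mat (k * pin \<tau> (cur \<tau>) + Suc c - Suc k) * vec \<sigma> (k * u + Suc c)) /
       (\<Sum>c<k. vec \<sigma> (k * u + Suc c))) \<tau>)"

definition next_root_step :: "machine \<Rightarrow> machine" where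
  "next_root_step \<sigma> = \<sigma>\<lparr>res := res \<sigma> * (\<Sum>c<k. vec \<sigma> (k * cur \<sigma> + Suc c)),
     root := Suc (root \<sigma>), cur := Suc (root \<sigma>), ptr := (ptr \<sigma>)(cur \<sigma> := M),
     pin := (pin \<sigma>)(cur \<sigma> := 0, Suc (root \<sigma>) := 1), vec := ones_at k (Suc (root \<sigma>)) k (vec \<sigma>)\<rparr>"

definition step :: "machine \<Rightarrow> machine" where
  "step \<sigma> =
     (if pin \<sigma> (cur \<sigma>) \<le> k
      then if ptr \<sigma> (cur \<sigma>) < M then scan_step \<sigma> else next_colour_step \<sigma>
      else if 0 < dep \<sigma> then pop_step \<sigma> else next_root_step \<sigma>)"

lemma run_scale_vec:
  "view (run (scale_vec k z) s) = rescale (cval z s) (view s) \<and>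
   (inputs (run (scale_vec k z) s) \<longleftrightarrow> inputs s)"
  by (simp add: scale_vec_def cstore_def view_def rescale_def Let_def inputs_def)

lemma run_push:
  "view (run (push k) s) = push_step (nmem s ''oth'' 0) (view s) \<and> (inputs (run (push k) s) \<longleftrightarrow> inputs s)"
  if "nmem s ''max'' 0 = m"
  using that
  by (simp add: push_def run_set_ones nstore_def view_def push_step_def inputs_def)

lemma run_scan:
  assumes "inputs s"
  shows "view (run (scan k) s) = scan_step (view s) \<and> inputs (run (scan k) s)"
proof -
  define v e where "v = nmem s ''cur'' 0" and "e = nmem s ''ptr'' v"
  define s1 where "s1 = nstore ''ptr'' v (Suc e) (nstore ''edge'' 0 e s)"
  define s2 where "s2 = nstore ''oth'' 0 (x e + y e - v) s1"
  have in1: "inputs s1" and in2: "inputs s2"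
    using assms by (auto simp: s1_def s2_def inputs_def nstore_def)
  have v1: "view s1 = (view s)\<lparr>ptr := (nmem s ''ptr'')(v := Suc e)\<rparr>" and v2: "view s2 = view s1"
    by (simp_all add: s1_def s2_def view_def nstore_def)
  have max: "nmem s2 ''max'' 0 = m"
    using in2 by (simp add: inputs_def)
  have acc: "nmem s1 ''edge'' 0 = e" "nmem s1 ''cur'' 0 = v" "nmem s1 ''end1'' = x" "nmem s1 ''end2'' = y"
    "nmem s2 ''edge'' 0 = e" "nmem s2 ''oth'' 0 = x e + y e - v" "nmem s2 ''ptr'' = (nmem s ''ptr'')(v := Suc e)"
    "nmem s2 ''pin'' = nmem s ''pin''" "nmem s2 ''cur'' 0 = v" "cmem s2 ''matrix'' = mat"
    using in1 in2 by (simp_all add: s1_def s2_def inputs_def nstore_def v_def)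
  have run: "run (scan k) s = (if x e = v \<or> y e = v
     then if e < ((nmem s ''ptr'')(v := Suc e)) (x e + y e - v) then s2
       else if 0 < nmem s ''pin'' (x e + y e - v)
         then run (scale_vec k (CCell ''matrix''
               (mat_index k (NCell ''pin'' (scalar ''cur'')) (NCell ''pin'' (scalar ''oth''))))) s2
         else run (push k) s2
     else s1)"
  proof -
    have "run (scan k) s =
      run (Cond (test_or (nequal (NCell ''end1'' (scalar ''edge'')) (scalar ''cur''))
                   (nequal (NCell ''end2'' (scalar ''edge'')) (scalar ''cur'')))
      (Seq (NAssign ''oth'' (NConst 0)
             (NSub (NAdd (NCell ''end1'' (scalar ''edge'')) (NCell ''end2'' (scalar ''edge''))) (scalar ''cur'')))
        (Cond (NLess (scalar ''edge'') (NCell ''ptr'' (scalar ''oth'')))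
          Skip
          (Cond (NLess (NConst 0) (NCell ''pin'' (scalar ''oth'')))
            (scale_vec k (CCell ''matrix''
               (mat_index k (NCell ''pin'' (scalar ''cur'')) (NCell ''pin'' (scalar ''oth'')))))
            (push k))))
      Skip) s1"
      by (simp add: scan_def s1_def e_def v_def nstore_def)
    then show ?thesis
      by (simp add: acc s2_def[symmetric])
  qed
  have cv: "cur (view s) = v" "ptr (view s) = nmem s ''ptr''" "pin (view s) = nmem s ''pin''"
    by (simp_all add: view_def v_def)
  show ?thesis
    unfolding run scan_step_def Let_def cv e_def[symmetric]
    using in1 in2 v1 v2 run_push[OF max] run_scale_vec[of _ s2]
    by (simp add: acc not_less[symmetric])
qed

lemma run_next_colour:
  "inputs s \<Longrightarrow> view (run next_colour s) = next_colour_step (view s) \<and> inputs (run next_colour s)"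
  by (simp add: next_colour_def next_colour_step_def view_def nstore_def inputs_def)

lemma run_pop:
  assumes "inputs s"
  shows "view (run (pop k) s) = pop_step (view s) \<and> inputs (run (pop k) s)"
proof -
  define u where "u = nmem s ''cur'' 0"
  define s1 where "s1 = nstore ''dep'' 0 (nmem s ''dep'' 0 - 1) (nstore ''pin'' u 0
    (nstore ''cur'' 0 (nmem s ''par'' u) (nstore ''oth'' 0 u s)))"
  have in1: "inputs s1"
    using assms by (auto simp: s1_def inputs_def nstore_def)
  have v1: "view s1 = (view s)\<lparr>cur := par (view s) u, pin := (pin (view s))(u := 0), dep := dep (view s) - 1\<rparr>"
    by (simp add: s1_def view_def nstore_def)
  have acc: "nmem s1 ''oth'' 0 = u" "nmem s1 ''cur'' 0 = par (view s) u" "nmem s1 ''pin'' = (pin (view s))(u := 0)"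
    "cmem s1 ''vec'' = vec (view s)" "cmem s1 ''matrix'' = mat" "cur (view s) = u"
    using in1 by (simp_all add: s1_def view_def inputs_def nstore_def u_def)
  have "run (pop k) s = run (scale_vec k (CDiv
           (csum k (\<lambda>c. CMul
             (CCell ''matrix'' (mat_index k (NCell ''pin'' (scalar ''cur'')) (NConst (Suc c))))
             (CCell ''vec'' (vec_index k (scalar ''oth'') (NConst (Suc c))))))
           (vec_sum k (scalar ''oth'')))) s1"
    by (simp add: pop_def s1_def u_def nstore_def)
  then show ?thesis
    using run_scale_vec[of _ s1] in1
    by (simp add: pop_step_def Let_def v1 acc vec_sum_def)
qed

lemma run_next_root:
  assumes "inputs s"
  shows "view (run (next_root k) s) = next_root_step (view s) \<and> inputs (run (next_root k) s)"
  using assms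
  by (simp add: next_root_def next_root_step_def run_set_ones vec_sum_def view_def nstore_def cstore_def
      inputs_def)

lemma run_body:
  assumes "inputs s"
  shows "view (run (body k) s) = step (view s) \<and> inputs (run (body k) s)"
proof -
  have "nmem s ''edges'' 0 = M"
    using assms by (simp add: inputs_def)
  then show ?thesis
    using run_scan[OF assms] run_next_colour[OF assms] run_pop[OF assms] run_next_root[OF assms]
    by (auto simp: body_def step_def view_def less_Suc_eq_le)
qed

text \<open>Every step carries the condition of the main loop, so that \<open>reach\<close>
  translates into \<open>iterates\<close>.\<close>

fun reach :: "nat \<Rightarrow> machine \<Rightarrow> machine \<Rightarrow> bool" where
  "reach 0 \<sigma> \<tau> \<longleftrightarrow> \<sigma> = \<tau>"
| "reach (Suc j) \<sigma> \<tau> \<longleftrightarrow> root \<sigma> < n \<and> reach j (step \<sigma>) \<tau>"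

lemma reach_trans: "reach i \<rho> \<sigma> \<Longrightarrow> reach j \<sigma> \<tau> \<Longrightarrow> reach (i + j) \<rho> \<tau>"
  by (induction i arbitrary: \<rho>) auto

lemma iterates_reach:
  assumes "inputs s" "reach j (view s) \<tau>"
  shows "\<exists>s'. iterates (NLess (scalar ''root'') (scalar ''vertices'')) (body k) j s s' \<and>
    view s' = \<tau> \<and> inputs s'"
  using assms
proof (induction j arbitrary: s)
  case 0
  then show ?case by auto
next
  case (Suc j)
  have "nmem s ''root'' 0 < nmem s ''vertices'' 0"
    using Suc.prems by (simp add: view_def inputs_def)
  moreover have "inputs (run (body k) s)" "reach j (view (run (body k) s)) \<tau>"
    using run_body[OF Suc.prems(1)] Suc.prems(2) by auto
  from Suc.IH[OF this] obtain s' where "iterates (NLess (scalar ''root'') (scalar ''vertices'')) (body k) j (run (body k) s) s'"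
    "view s' = \<tau>" "inputs s'" by blast
  ultimately show ?case by auto
qed

end

section \<open>Correctness of the traversal\<close>

lemma vec_index_inj:
  fixes k :: nat
  assumes "c < k" "c' < k"
  shows "k * v + Suc c = k * u + Suc c' \<longleftrightarrow> v = u \<and> c = c'"
proof
  assume "k * v + Suc c = k * u + Suc c'"
  then have "k * v + c = k * u + c'" by simp
  then have "(k * v + c) div k = (k * u + c') div k" "(k * v + c) mod k = (k * u + c') mod k" by simp_all
  then show "v = u \<and> c = c'" using assms by simp
qed auto

locale tree_computation = bounded_graph n M k D x y + tree_machine n M k m x y mat
  for n M k D m :: nat and x y :: "nat \<Rightarrow> nat" and mat :: "nat \<Rightarrow> complex"
begin

definition a :: "nat \<Rightarrow> nat \<Rightarrow> complex" where
  "a i j = mat (k * i + j)"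

definition vec_at :: "machine \<Rightarrow> nat \<Rightarrow> nat \<Rightarrow> complex" where
  "vec_at \<sigma> v c = vec \<sigma> (k * v + Suc c)"

text \<open>A free vertex is either untouched (pointer 0) or a former root with all edges deleted
  (pointer at least \<open>M\<close>).\<close>

definition config :: "(nat \<Rightarrow> nat) \<Rightarrow> (nat \<Rightarrow> nat) \<Rightarrow> nat \<Rightarrow> bool" where
  "config S q v \<longleftrightarrow> v < n \<and> S v = 0 \<and> q v = 0 \<and> (\<forall>u. S u \<le> k) \<and> (\<forall>u. S u = 0 \<longrightarrow> q u = 0 \<or> M \<le> q u)"

text \<open>What a visit must preserve: only pinned vertices lie on the stack below
  \<open>v\<close>, so the vectors and links of other vertices may be overwritten.\<close>

definition same_frame :: "(nat \<Rightarrow> nat) \<Rightarrow> nat \<Rightarrow> machine \<Rightarrow> machine \<Rightarrow> bool" where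
  "same_frame S v \<sigma> \<tau> \<longleftrightarrow> dep \<tau> = dep \<sigma> \<and> root \<tau> = root \<sigma> \<and> res \<tau> = res \<sigma> \<and>
     (\<forall>u. S u \<noteq> 0 \<or> u = v \<longrightarrow> par \<tau> u = par \<sigma> u) \<and>
     (\<forall>u c. S u \<noteq> 0 \<and> c < k \<longrightarrow> vec_at \<tau> u c = vec_at \<sigma> u c)"

text \<open>Here \<open>d\<close> is the remaining depth. A root has \<open>dep\<close> 0 and
  remaining depth \<open>Suc m\<close>, so the tree is truncated at depth
  \<open>m + 1\<close>.\<close>

definition ready :: "nat \<Rightarrow> (nat \<Rightarrow> nat) \<Rightarrow> (nat \<Rightarrow> nat) \<Rightarrow> nat \<Rightarrow> machine \<Rightarrow> bool" where
  "ready d S q v \<sigma> \<longleftrightarrow> config S q v \<and> root \<sigma> < n \<and> dep \<sigma> + d = Suc m \<and> cur \<sigma> = v \<and>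
     pin \<sigma> = S(v := if d = 0 then Suc k else 1) \<and> ptr \<sigma> = q \<and> (\<forall>c<k. vec_at \<sigma> v c = 1)"

definition finished :: "nat \<Rightarrow> (nat \<Rightarrow> nat) \<Rightarrow> (nat \<Rightarrow> nat) \<Rightarrow> nat \<Rightarrow> machine \<Rightarrow> machine \<Rightarrow> bool" where
  "finished d S q v \<sigma> \<tau> \<longleftrightarrow> same_frame S v \<sigma> \<tau> \<and> cur \<tau> = v \<and> pin \<tau> = S(v := Suc k) \<and> ptr \<tau> = q \<and>
     (\<forall>c<k. vec_at \<tau> v c = W a d S q v c)"

abbreviation child_factor :: "nat \<Rightarrow> (nat \<Rightarrow> nat) \<Rightarrow> (nat \<Rightarrow> nat) \<Rightarrow> nat \<Rightarrow> nat \<Rightarrow> nat \<Rightarrow> complex" where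
  "child_factor d S q v i e \<equiv> factor a S q v i e (W a d (S(v := Suc i)) (q(v := Suc e)) (oth e v))"

text \<open>The invariant of the nested loops over colours and edges: colours below \<open>i\<close>
  are done, and colour \<open>i\<close> has absorbed the edges below \<open>p\<close>. For
  \<open>i = k\<close> and \<open>p = 0\<close> it yields \<open>finished\<close>.\<close>

definition scanned ::
  "nat \<Rightarrow> (nat \<Rightarrow> nat) \<Rightarrow> (nat \<Rightarrow> nat) \<Rightarrow> nat \<Rightarrow> nat \<Rightarrow> nat \<Rightarrow> machine \<Rightarrow> machine \<Rightarrow> bool" where
  "scanned d S q v i p \<sigma> \<tau> \<longleftrightarrow> same_frame S v \<sigma> \<tau> \<and> cur \<tau> = v \<and> pin \<tau> = S(v := Suc i) \<and>
     ptr \<tau> = q(v := p) \<and>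
     (\<forall>c<k. vec_at \<tau> v c = (if c < i then W a (Suc d) S q v c
        else if c = i then \<Prod>e<p. child_factor d S q v i e else 1))"

lemma same_frame_trans:
  "same_frame S v \<rho> \<sigma> \<Longrightarrow> same_frame S v \<sigma> \<tau> \<Longrightarrow> same_frame S v \<rho> \<tau>"
  by (simp add: same_frame_def)

lemma vec_at_rescale:
  assumes "pin \<sigma> (cur \<sigma>) = Suc i" "i < k" "c < k"
  shows "vec_at (rescale z \<sigma>) u c = (if u = cur \<sigma> \<and> c = i then vec_at \<sigma> u c * z else vec_at \<sigma> u c)"
  using vec_index_inj[OF assms(3,2), of u "cur \<sigma>"] assms(1)
  by (auto simp: vec_at_def rescale_def Let_def)

lemma vec_at_ones_at:
  assumes "c < k"
  shows "ones_at k u k f (k * w + Suc c) = (if w = u then 1 else f (k * w + Suc c))"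
proof -
  have "w = u" if "k * u < k * w + Suc c" "k * w + Suc c \<le> k * u + k"
  proof -
    have u: "k * u \<le> k * w + c" "k * w + c < k * Suc u"
      using that by auto
    have "k * u < k * Suc w" "k * w < k * Suc u"
      using u assms by auto
    then have "u < Suc w" "w < Suc u"
      by (metis mult_less_cancel1)+
    then show ?thesis by simp
  qed
  then show ?thesis using assms by (auto simp: ones_at_def)
qed

lemma scanned_extend:
  assumes sc: "scanned d S q v i p \<sigma> \<tau>" and i: "i < k" and frame: "same_frame S v \<tau> \<tau>'"
    and c: "cur \<tau>' = v" "pin \<tau>' = S(v := Suc i)" "ptr \<tau>' = q(v := Suc p)"
    and vec: "\<And>c. c < k \<Longrightarrow> vec_at \<tau>' v c =
      (if c = i then vec_at \<tau> v c * child_factor d S q v i p else vec_at \<tau> v c)"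
  shows "scanned d S q v i (Suc p) \<sigma> \<tau>'"
  using sc vec c same_frame_trans[OF _ frame]
  by (auto simp: scanned_def)

text \<open>Per colour: \<open>M\<close> scans, at most \<open>D\<close> child visits with one pop
  each, and one change of colour.\<close>

primrec visit_steps :: "nat \<Rightarrow> nat" where
  "visit_steps 0 = 0"
| "visit_steps (Suc d) = k * (M + D * (visit_steps d + 1) + 1)"

text \<open>The assumption \<open>visit\<close> is the induction hypothesis of the later lemma of
  that name.\<close>

lemma scan_edge:
  assumes visit: "\<And>\<sigma> v S q. ready d S q v \<sigma> \<Longrightarrow>
      \<exists>j\<le>visit_steps d. \<exists>\<tau>. reach j \<sigma> \<tau> \<and> finished d S q v \<sigma> \<tau>"
    and cf: "config S q v" and root: "root \<sigma> < n" and dep: "dep \<sigma> + Suc d = Suc m"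
    and sc: "scanned d S q v i p \<sigma> \<tau>" and i: "i < k" and p: "p < M"
  shows "\<exists>j\<le>1 + (if inc p v then visit_steps d + 1 else 0). \<exists>\<tau>'. reach j \<tau> \<tau>' \<and>
      scanned d S q v i (Suc p) \<sigma> \<tau>'"
proof -
  let ?u = "oth p v" and ?S = "S(v := Suc i)" and ?q = "q(v := Suc p)"
  define \<tau>1 where "\<tau>1 = \<tau>\<lparr>ptr := ?q\<rparr>"
  have cur: "cur \<tau> = v" "pin \<tau> = ?S" "ptr \<tau> = q(v := p)" and fr: "same_frame S v \<sigma> \<tau>"
    using sc by (auto simp: scanned_def)
  have root\<tau>: "root \<tau> < n" and dep\<tau>: "dep \<tau> + Suc d = Suc m"
    using fr root dep by (auto simp: same_frame_def)
  have cf': "v < n" "S v = 0" "q v = 0" "\<And>u. S u \<le> k" "\<And>u. S u = 0 \<Longrightarrow> q u = 0 \<or> M \<le> q u"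
    using cf by (auto simp: config_def)
  have step: "step \<tau> = (if inc p v \<and> ?q ?u \<le> p
     then if ?S ?u \<noteq> 0 then rescale (mat (k * Suc i + ?S ?u - Suc k)) \<tau>1 else push_step ?u \<tau>1 else \<tau>1)"
    using i p cur by (simp add: step_def scan_step_def Let_def inc_def oth_def \<tau>1_def)
  have frame1: "same_frame S v \<tau> \<tau>1" and vec1: "vec_at \<tau>1 = vec_at \<tau>"
    by (auto simp: \<tau>1_def same_frame_def vec_at_def fun_eq_iff)
  have \<tau>1: "cur \<tau>1 = v" "pin \<tau>1 = ?S" "ptr \<tau>1 = ?q" "par \<tau>1 = par \<tau>" "dep \<tau>1 = dep \<tau>" "root \<tau>1 = root \<tau>"
    "res \<tau>1 = res \<tau>"
    using cur by (auto simp: \<tau>1_def)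
  consider (skip) "\<not> inc p v \<or> p < q ?u" | (pinned) "inc p v" "q ?u \<le> p" "S ?u \<noteq> 0"
    | (free) "inc p v" "q ?u \<le> p" "S ?u = 0"
    by linarith
  then show ?thesis
  proof cases
    case skip
    have "\<not> (inc p v \<and> ?q ?u \<le> p)"
      using skip by auto
    then have "step \<tau> = \<tau>1"
      unfolding step by (rule if_not_P)
    moreover have "scanned d S q v i (Suc p) \<sigma> \<tau>1"
      using skip by (intro scanned_extend[OF sc i frame1]) (auto simp: \<tau>1 vec1 factor_def)
    ultimately show ?thesis
      using root\<tau> by (intro exI[of _ 1]) auto
  next
    case pinned
    have u: "?u \<noteq> v" using oth_neq[OF p pinned(1)] .
    define z where "z = mat (k * Suc i + ?S ?u - Suc k)"
    have "step \<tau> = rescale z \<tau>1"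
      unfolding step z_def using pinned u by simp
    moreover have "z = child_factor d S q v i p"
    proof -
      have "k * Suc i + S ?u - Suc k = k * i + (S ?u - 1)"
        using pinned(3) by simp
      then show ?thesis
        using pinned u by (simp add: z_def factor_def a_def)
    qed
    moreover have "scanned d S q v i (Suc p) \<sigma> (rescale (child_factor d S q v i p) \<tau>1)"
    proof (rule scanned_extend[OF sc i])
      fix c assume "c < k"
      then show "vec_at (rescale (child_factor d S q v i p) \<tau>1) v c =
        (if c = i then vec_at \<tau> v c * child_factor d S q v i p else vec_at \<tau> v c)"
        by (subst vec_at_rescale[where i = i]) (use i in \<open>auto simp: \<tau>1 vec1\<close>)
    next
      have "vec_at (rescale z \<tau>1) w c = vec_at \<tau> w c" if "c < k" "S w \<noteq> 0" for w c z
        by (subst vec_at_rescale[where i = i]) (use i that cf' in \<open>auto simp: \<tau>1 vec1\<close>)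
      then show "same_frame S v \<tau> (rescale (child_factor d S q v i p) \<tau>1)"
        unfolding same_frame_def by (auto simp: rescale_def Let_def \<tau>1)
    qed (auto simp: rescale_def Let_def \<tau>1)
    ultimately show ?thesis
      using root\<tau> by (intro exI[of _ 1]) auto
  next
    case free
    have u: "?u \<noteq> v" "?u < n" using oth_neq[OF p free(1)] oth_less[OF p free(1)] .
    \<comment> \<open>The edge is present, so the pointer of \<open>?u\<close> is at most
      \<open>p < M\<close>; for a free vertex this forces 0, and \<open>push\<close> need not reset
      it.\<close>
    have qu: "q ?u = 0"
      using cf'(5)[OF free(3)] free(2) p by auto
    define \<rho> where "\<rho> = push_step ?u \<tau>1"
    have step1: "step \<tau> = \<rho>"
      unfolding step \<rho>_def using free u by simp
    have vec\<rho>: "vec_at \<rho> w c = (if w = ?u then 1 else vec_at \<tau> w c)" if "c < k" for w c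
      using vec_at_ones_at[OF that, of ?u "vec \<tau>1" w] vec1
      by (simp add: \<rho>_def push_step_def vec_at_def fun_eq_iff)
    have \<rho>: "root \<rho> = root \<tau>" "dep \<rho> = Suc (dep \<tau>)" "cur \<rho> = ?u" "res \<rho> = res \<tau>"
      "pin \<rho> = ?S(?u := if dep \<tau> < m then 1 else Suc k)" "ptr \<rho> = ?q" "par \<rho> = (par \<tau>)(?u := v)"
      by (simp_all add: \<rho>_def push_step_def \<tau>1)
    have "config ?S ?q ?u"
      unfolding config_def using u qu free(3) cf' i by auto
    moreover have "dep \<tau> < m \<longleftrightarrow> d \<noteq> 0"
      using dep\<tau> by auto
    ultimately have "ready d ?S ?q ?u \<rho>"
      unfolding ready_def using root\<tau> dep\<tau> by (simp add: \<rho> vec\<rho>)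
    from visit[OF this] obtain j \<rho>' where j: "j \<le> visit_steps d" "reach j \<rho> \<rho>'"
      and fin: "finished d ?S ?q ?u \<rho> \<rho>'"
      by blast
    have \<rho>': "root \<rho>' = root \<tau>" "dep \<rho>' = Suc (dep \<tau>)" "cur \<rho>' = ?u" "res \<rho>' = res \<tau>"
      "pin \<rho>' = ?S(?u := Suc k)" "ptr \<rho>' = ?q" "par \<rho>' ?u = v"
      using fin by (auto simp: finished_def same_frame_def \<rho>)
    have par\<rho>': "par \<rho>' w = par \<tau> w" if "S w \<noteq> 0 \<or> w = v" for w
    proof -
      have "w \<noteq> ?u" using that u free(3) by auto
      moreover have "?S w \<noteq> 0" using that by auto
      ultimately show ?thesis
        using fin unfolding finished_def same_frame_def by (simp add: \<rho>)
    qed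
    have vec\<rho>': "vec_at \<rho>' w c = vec_at \<tau> w c" if "S w \<noteq> 0 \<or> w = v" "c < k" for w c
    proof -
      have "w \<noteq> ?u" using that u free(3) by auto
      moreover have "?S w \<noteq> 0" using that by auto
      ultimately show ?thesis
        using fin that(2) unfolding finished_def same_frame_def by (simp add: vec\<rho>)
    qed
    have vecu: "vec \<rho>' (Suc (k * ?u + c)) = W a d ?S ?q ?u c" if "c < k" for c
      using fin that by (simp add: finished_def vec_at_def)
    define \<pi> where "\<pi> = \<rho>'\<lparr>cur := v, pin := ?S, dep := dep \<tau>\<rparr>"
    have pin_back: "(?S(?u := Suc k))(?u := 0) = ?S"
      using free(3) u by (auto simp: fun_eq_iff)
    have avg: "(\<Sum>c<k. mat (k * Suc i + Suc c - Suc k) * vec \<rho>' (k * ?u + Suc c)) /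
        (\<Sum>c<k. vec \<rho>' (k * ?u + Suc c)) = child_factor d S q v i p"
      using free u by (simp add: factor_def average_def a_def vecu)
    have "step \<rho>' = pop_step \<rho>'"
      by (simp add: step_def \<rho>')
    also have "\<dots> = rescale (child_factor d S q v i p) \<pi>"
      unfolding pop_step_def Let_def \<rho>' pin_back
      by (simp add: \<pi>_def avg[symmetric] del: mult_Suc_right)
    finally have step2: "step \<rho>' = rescale (child_factor d S q v i p) \<pi>" .
    have \<pi>: "cur \<pi> = v" "pin \<pi> = ?S" "ptr \<pi> = ?q" "root \<pi> = root \<tau>" "dep \<pi> = dep \<tau>" "res \<pi> = res \<tau>"
      "par \<pi> = par \<rho>'" "vec_at \<pi> = vec_at \<rho>'"
      by (auto simp: \<pi>_def \<rho>' vec_at_def fun_eq_iff)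
    have "scanned d S q v i (Suc p) \<sigma> (rescale (child_factor d S q v i p) \<pi>)"
    proof (rule scanned_extend[OF sc i])
      fix c assume "c < k"
      then show "vec_at (rescale (child_factor d S q v i p) \<pi>) v c =
        (if c = i then vec_at \<tau> v c * child_factor d S q v i p else vec_at \<tau> v c)"
        by (subst vec_at_rescale[where i = i]) (use i in \<open>auto simp: \<pi> vec\<rho>'\<close>)
    next
      have "vec_at (rescale z \<pi>) w c = vec_at \<tau> w c" if "c < k" "S w \<noteq> 0" for w c z
        by (subst vec_at_rescale[where i = i]) (use i that cf' in \<open>auto simp: \<pi> vec\<rho>'\<close>)
      then show "same_frame S v \<tau> (rescale (child_factor d S q v i p) \<pi>)"
        unfolding same_frame_def by (auto simp: rescale_def Let_def \<pi> par\<rho>')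
    qed (auto simp: rescale_def Let_def \<pi>)
    moreover have "reach (Suc j + 1) \<tau> (rescale (child_factor d S q v i p) \<pi>)"
    proof (rule reach_trans)
      show "reach (Suc j) \<tau> \<rho>'"
        using root\<tau> j(2) step1 by simp
      show "reach 1 \<rho>' (rescale (child_factor d S q v i p) \<pi>)"
        using root\<tau> step2 \<rho>' by simp
    qed
    ultimately show ?thesis
      using j(1) free(1) by (intro exI[of _ "Suc j + 1"]) auto
  qed
qed

lemma scan_edges:
  assumes visit: "\<And>\<sigma> v S q. ready d S q v \<sigma> \<Longrightarrow>
      \<exists>j\<le>visit_steps d. \<exists>\<tau>. reach j \<sigma> \<tau> \<and> finished d S q v \<sigma> \<tau>"
    and cf: "config S q v" and root: "root \<sigma> < n" and dep: "dep \<sigma> + Suc d = Suc m"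
    and sc: "scanned d S q v i 0 \<sigma> \<tau>" and i: "i < k" and p: "p \<le> M"
  shows "\<exists>j\<le>p + card {e. e < p \<and> inc e v} * (visit_steps d + 1). \<exists>\<tau>'. reach j \<tau> \<tau>' \<and>
      scanned d S q v i p \<sigma> \<tau>'"
  using p
proof (induction p)
  case 0
  then show ?case using sc by auto
next
  case (Suc p)
  then obtain j \<tau>1 where j: "j \<le> p + card {e. e < p \<and> inc e v} * (visit_steps d + 1)"
    "reach j \<tau> \<tau>1" "scanned d S q v i p \<sigma> \<tau>1" by auto
  obtain j' \<tau>2 where j': "j' \<le> 1 + (if inc p v then visit_steps d + 1 else 0)"
    "reach j' \<tau>1 \<tau>2" "scanned d S q v i (Suc p) \<sigma> \<tau>2"
    using scan_edge[OF visit cf root dep j(3) i] Suc.prems by auto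
  have "{e. e < Suc p \<and> inc e v} = (if inc p v then insert p {e. e < p \<and> inc e v} else {e. e < p \<and> inc e v})"
    by (auto simp: less_Suc_eq)
  then have "card {e. e < Suc p \<and> inc e v} = card {e. e < p \<and> inc e v} + (if inc p v then 1 else 0)"
    by simp
  then have "j + j' \<le> Suc p + card {e. e < Suc p \<and> inc e v} * (visit_steps d + 1)"
    using j(1) j'(1) by (auto split: if_splits)
  then show ?case
    using reach_trans[OF j(2) j'(2)] j'(3) by blast
qed

lemma next_colour:
  assumes cf: "config S q v" and root: "root \<sigma> < n"
    and sc: "scanned d S q v i M \<sigma> \<tau>" and i: "i < k"
  shows "\<exists>\<tau>'. reach 1 \<tau> \<tau>' \<and> scanned d S q v (Suc i) 0 \<sigma> \<tau>'"
proof -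
  have cur: "cur \<tau> = v" "pin \<tau> = S(v := Suc i)" "ptr \<tau> = q(v := M)" and fr: "same_frame S v \<sigma> \<tau>"
    and vec: "\<And>c. c < k \<Longrightarrow> vec_at \<tau> v c = (if c < i then W a (Suc d) S q v c
        else if c = i then \<Prod>e<M. child_factor d S q v i e else 1)"
    using sc by (auto simp: scanned_def)
  \<comment> \<open>As \<open>q v = 0\<close>, the product over the remaining edges in
    \<open>W\<close> runs over all of them.\<close>
  have W: "(\<Prod>e<M. child_factor d S q v i e) = W a (Suc d) S q v i"
    using cf by (simp add: config_def atLeast0LessThan)
  have "step \<tau> = next_colour_step \<tau>"
    using cur i by (simp add: step_def)
  moreover have "scanned d S q v (Suc i) 0 \<sigma> (next_colour_step \<tau>)"
    unfolding scanned_def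
  proof (intro conjI allI impI)
    fix c assume c: "c < k"
    have "vec_at (next_colour_step \<tau>) v c = vec_at \<tau> v c"
      by (simp add: next_colour_step_def vec_at_def)
    then show "vec_at (next_colour_step \<tau>) v c = (if c < Suc i then W a (Suc d) S q v c
        else if c = Suc i then \<Prod>e<0. child_factor d S q v (Suc i) e else 1)"
      using vec[OF c] W by (auto simp del: W.simps simp: less_Suc_eq)
  qed (use fr in \<open>auto simp: next_colour_step_def cur same_frame_def vec_at_def\<close>)
  moreover have "root \<tau> < n"
    using fr root by (simp add: same_frame_def)
  ultimately show ?thesis by auto
qed

lemma visit: "ready d S q v \<sigma> \<Longrightarrow> \<exists>j\<le>visit_steps d. \<exists>\<tau>. reach j \<sigma> \<tau> \<and> finished d S q v \<sigma> \<tau>"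
proof (induction d arbitrary: S q v \<sigma>)
  case 0
  \<comment> \<open>At depth 0 the frame is already complete, so no step is taken.\<close>
  then have "finished 0 S q v \<sigma> \<sigma>"
    by (auto simp: ready_def finished_def same_frame_def)
  then show ?case by (intro exI[of _ 0]) auto
next
  case (Suc d)
  note visit = Suc.IH
  let ?B = "M + D * (visit_steps d + 1) + 1"
  have cf: "config S q v" and root: "root \<sigma> < n" and dep: "dep \<sigma> + Suc d = Suc m"
    using Suc.prems by (auto simp: ready_def)
  have "card {e. e < M \<and> inc e v} \<le> D"
    using degree cf by (auto simp: config_def inc_def)
  then have B: "M + card {e. e < M \<and> inc e v} * (visit_steps d + 1) + 1 \<le> ?B"
    by (intro add_right_mono add_left_mono mult_right_mono) auto
  have "\<exists>j\<le>i * ?B. \<exists>\<tau>. reach j \<sigma> \<tau> \<and> scanned d S q v i 0 \<sigma> \<tau>" if "i \<le> k" for i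
    using that
  proof (induction i)
    case 0
    have "q(v := 0) = q"
      using cf by (auto simp: config_def)
    then have "scanned d S q v 0 0 \<sigma> \<sigma>"
      using Suc.prems by (auto simp: ready_def scanned_def same_frame_def)
    then show ?case by auto
  next
    case (Suc i)
    then obtain j \<tau> where j: "j \<le> i * ?B" "reach j \<sigma> \<tau>" "scanned d S q v i 0 \<sigma> \<tau>"
      by auto
    obtain j' \<tau>' where j': "j' \<le> M + card {e. e < M \<and> inc e v} * (visit_steps d + 1)"
      "reach j' \<tau> \<tau>'" "scanned d S q v i M \<sigma> \<tau>'"
      using scan_edges[OF visit cf root dep j(3), of M] Suc.prems by auto
    obtain \<tau>'' where "reach 1 \<tau>' \<tau>''" "scanned d S q v (Suc i) 0 \<sigma> \<tau>''"
      using next_colour[OF cf root j'(3)] Suc.prems by auto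
    moreover have "j + j' + 1 \<le> Suc i * ?B"
      using j(1) j'(1) B by simp
    ultimately show ?case
      using reach_trans[OF reach_trans[OF j(2) j'(2)]] by blast
  qed
  from this[of k] obtain j \<tau> where j: "j \<le> k * ?B" "reach j \<sigma> \<tau>" "scanned d S q v k 0 \<sigma> \<tau>"
    by auto
  have "q(v := 0) = q"
    using cf by (auto simp: config_def)
  then have "finished (Suc d) S q v \<sigma> \<tau>"
    using j(3) by (simp add: scanned_def finished_def)
  with j show ?case by auto
qed

end

section \<open>The loop over the roots and its number of steps\<close>

context tree_computation
begin

definition root_state :: "nat \<Rightarrow> machine \<Rightarrow> bool" where
  "root_state r \<sigma> \<longleftrightarrow> root \<sigma> = r \<and> cur \<sigma> = r \<and> dep \<sigma> = 0 \<and> pin \<sigma> = (\<lambda>_. 0)(r := 1) \<and>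
     ptr \<sigma> = root_pointers r \<and> (\<forall>c<k. vec_at \<sigma> r c = 1) \<and> res \<sigma> = (\<Prod>r'<r. Y a (Suc m) r')"

lemma next_root_state:
  assumes rs: "root_state r \<sigma>" and r: "r < n"
  shows "\<exists>j\<le>visit_steps (Suc m) + 1. \<exists>\<tau>. reach j \<sigma> \<tau> \<and> root_state (Suc r) \<tau>"
proof -
  have "ready (Suc m) (\<lambda>_. 0) (root_pointers r) r \<sigma>"
    using rs r by (auto simp: root_state_def ready_def config_def root_pointers_def)
  from visit[OF this] obtain j \<tau> where j: "j \<le> visit_steps (Suc m)" "reach j \<sigma> \<tau>"
    and fin: "finished (Suc m) (\<lambda>_. 0) (root_pointers r) r \<sigma> \<tau>" by blast
  have \<tau>: "root \<tau> = r" "cur \<tau> = r" "dep \<tau> = 0" "res \<tau> = (\<Prod>r'<r. Y a (Suc m) r')"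
    "pin \<tau> = (\<lambda>_. 0)(r := Suc k)" "ptr \<tau> = root_pointers r"
    using fin rs by (auto simp: finished_def same_frame_def root_state_def)
  have vec: "vec \<tau> (k * r + Suc c) = W a (Suc m) (\<lambda>_. 0) (root_pointers r) r c" if "c < k" for c
    using fin that by (simp add: finished_def vec_at_def)
  have "(\<Sum>c<k. vec \<tau> (k * r + Suc c)) = Y a (Suc m) r"
    unfolding Y_def by (intro sum.cong refl vec) auto
  moreover have "step \<tau> = next_root_step \<tau>"
    using \<tau> by (simp add: step_def)
  moreover have "(root_pointers r)(r := M) = root_pointers (Suc r)"
    by (auto simp: root_pointers_def)
  ultimately have "root_state (Suc r) (step \<tau>)"
    using vec_at_ones_at[of _ "Suc r" "vec \<tau>" "Suc r"]
    by (simp add: root_state_def next_root_step_def \<tau> vec_at_def mult.commute fun_upd_def fun_eq_iff)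
  moreover have "reach (j + 1) \<sigma> (step \<tau>)"
    using reach_trans[OF j(2), of 1 "step \<tau>"] \<tau> r by simp
  ultimately show ?thesis
    using j(1) by (intro exI[of _ "j + 1"]) auto
qed

lemma all_roots:
  assumes "root_state 0 \<sigma>"
  shows "\<exists>j\<le>n * (visit_steps (Suc m) + 1). \<exists>\<tau>. reach j \<sigma> \<tau> \<and> root_state n \<tau>"
proof -
  have "\<exists>j\<le>r * (visit_steps (Suc m) + 1). \<exists>\<tau>. reach j \<sigma> \<tau> \<and> root_state r \<tau>" if "r \<le> n" for r
    using that
  proof (induction r)
    case 0
    then show ?case using assms by auto
  next
    case (Suc r)
    then obtain j \<tau> where j: "j \<le> r * (visit_steps (Suc m) + 1)" "reach j \<sigma> \<tau>" "root_state r \<tau>"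
      by auto
    obtain j' \<tau>' where "j' \<le> visit_steps (Suc m) + 1" "reach j' \<tau> \<tau>'" "root_state (Suc r) \<tau>'"
      using next_root_state[OF j(3)] Suc.prems by auto
    moreover from this have "j + j' \<le> Suc r * (visit_steps (Suc m) + 1)"
      using j(1) by simp
    ultimately show ?case
      using reach_trans[OF j(2)] by blast
  qed
  then show ?thesis by blast
qed

text \<open>The branching is \<open>k * D\<close>; the base \<open>k * D + 1\<close> lets the
  additive term be absorbed without summing a geometric series.\<close>

lemma visit_steps_le: "visit_steps d \<le> k * (M + D + 1) * (k * D + 1) ^ d"
proof (induction d)
  case (Suc d)
  have "visit_steps (Suc d) = k * (M + D + 1) + k * D * visit_steps d"
    by (simp add: algebra_simps)
  also have "\<dots> \<le> k * (M + D + 1) * (k * D + 1) ^ d + k * D * (k * (M + D + 1) * (k * D + 1) ^ d)"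
    using Suc by (intro add_mono mult_left_mono) auto
  also have "\<dots> = k * (M + D + 1) * (k * D + 1) ^ Suc d"
    by (simp add: algebra_simps)
  finally show ?case .
qed simp

lemma edges_le: "M \<le> n * D"
proof -
  have "M = card {..<M}" by simp
  also have "\<dots> \<le> card (\<Union>v<n. {e. e < M \<and> (x e = v \<or> y e = v)})"
    using ends by (intro card_mono) auto
  also have "\<dots> \<le> (\<Sum>v<n. card {e. e < M \<and> (x e = v \<or> y e = v)})"
    by (intro card_UN_le) auto
  also have "\<dots> \<le> (\<Sum>v<n. D)"
    using degree by (intro sum_mono) auto
  finally show ?thesis by simp
qed

end

text \<open>\<open>''pow''\<close> holds \<open>1.03\<close> to the power \<open>''max''\<close>, the truncation depth.\<close>

definition prepare :: com where
  "prepare =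
     Seq (Cond (ReLess (CCell ''eps'' (NConst 0)) (COfNat (NConst 1)))
           (CAssign ''tol'' (NConst 0) (CCell ''eps'' (NConst 0)))
           (CAssign ''tol'' (NConst 0) (COfNat (NConst 1))))
         (CAssign ''pow'' (NConst 0) (COfNat (NConst 1)))"

text \<open>The condition of \<open>Y_ratio\<close> cleared of the division: repeated multiplication
  replaces a logarithm.\<close>

definition depth_test :: test where
  "depth_test = ReLess (CMul (CCell ''pow'' (NConst 0)) (CCell ''tol'' (NConst 0)))
     (CMul (COfNat (NConst 20)) (COfNat (scalar ''vertices'')))"

definition depth_body :: com where
  "depth_body =
     Seq (CAssign ''pow'' (NConst 0)
           (CMul (CCell ''pow'' (NConst 0)) (CDiv (COfNat (NConst 103)) (COfNat (NConst 100)))))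
         (NAssign ''max'' (NConst 0) (NAdd (scalar ''max'') (NConst 1)))"

definition first_root :: "nat \<Rightarrow> com" where
  "first_root k =
     Seq (CAssign ''result'' (NConst 0) (COfNat (NConst 1)))
    (Seq (NAssign ''pin'' (NConst 0) (NConst 1))
         (set_ones k (NConst 0) k))"

definition root_test :: test where
  "root_test = NLess (scalar ''root'') (scalar ''vertices'')"

definition program :: "nat \<Rightarrow> com" where
  "program k = Seq prepare (Seq (While depth_test depth_body) (Seq (first_root k) (While root_test (body k))))"

lemma loop_free_parts: "loop_free prepare" "loop_free depth_body" "loop_free (first_root k)"
  by (simp_all add: prepare_def depth_body_def first_root_def loop_free_set_ones)

definition depth_state :: "state \<Rightarrow> real \<Rightarrow> nat \<Rightarrow> state" where
  "depth_state s tol m = s\<lparr>nmem := (nmem s)(''max'' := (nmem s ''max'')(0 := m)),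
     cmem := (cmem s)(''tol'' := (cmem s ''tol'')(0 := complex_of_real tol),
       ''pow'' := (cmem s ''pow'')(0 := complex_of_real ((103/100) ^ m)))\<rparr>"

lemma run_prepare:
  assumes "cmem s ''eps'' 0 = complex_of_real \<epsilon>" "nmem s ''max'' 0 = 0"
  shows "run prepare s = depth_state s (min 1 \<epsilon>) 0"
proof -
  have "nmem s = (nmem s)(''max'' := (nmem s ''max'')(0 := 0))"
    using assms(2) by (auto simp: fun_eq_iff)
  then have "s = s\<lparr>nmem := (nmem s)(''max'' := (nmem s ''max'')(0 := 0))\<rparr>"
    by simp
  then show ?thesis
    using assms(1)
    by (auto simp: prepare_def depth_state_def cstore_def min_def)
qed

lemma run_depth_body: "run depth_body (depth_state s tol m) = depth_state s tol (Suc m)"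
  by (simp add: depth_body_def depth_state_def nstore_def cstore_def mult.commute)

lemma tval_depth_test:
  "tval depth_test (depth_state s tol m) \<longleftrightarrow> (103/100) ^ m * tol < 20 * real (nmem s ''vertices'' 0)"
  by (simp add: depth_test_def depth_state_def)

text \<open>The least exponent that fails the test exists by the Archimedean property. Its
  predecessor passes, which bounds the power from above; the summand 1 covers
  \<open>m = 0\<close>.\<close>

lemma depth_loop:
  assumes "0 < tol"
  shows "\<exists>m. iterates depth_test depth_body m (depth_state s tol 0) (depth_state s tol m) \<and>
    \<not> tval depth_test (depth_state s tol m) \<and>
    (103/100) ^ m \<le> 1 + 103/100 * (20 * real (nmem s ''vertices'' 0) / tol)"
proof -
  let ?P = "\<lambda>m. \<not> tval depth_test (depth_state s tol m)"
  obtain m0 where "20 * real (nmem s ''vertices'' 0) / tol < (103/100) ^ m0"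
    using real_arch_pow[of "103/100"] by auto
  then have "?P m0"
    using assms by (simp add: tval_depth_test field_simps)
  then obtain m where m: "?P m" and least: "\<And>i. i < m \<Longrightarrow> \<not> ?P i"
    using exists_least_iff[of ?P] by blast
  have "iterates depth_test depth_body (m - i) (depth_state s tol i) (depth_state s tol m)" if "i \<le> m" for i
    using that
  proof (induction i rule: inc_induct)
    case (step i)
    then have "m - i = Suc (m - Suc i)" by simp
    then show ?case
      using step least[of i] by (simp add: run_depth_body)
  qed simp
  from this[of 0] have "iterates depth_test depth_body m (depth_state s tol 0) (depth_state s tol m)"
    by simp
  moreover have "(103/100) ^ m \<le> 1 + 103/100 * (20 * real (nmem s ''vertices'' 0) / tol)"
  proof (cases m)
    case 0
    then show ?thesis using assms by simp
  next
    case (Suc i)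
    then have "(103/100) ^ i < 20 * real (nmem s ''vertices'' 0) / tol"
      using least[of i] assms by (simp add: tval_depth_test field_simps)
    then have "103/100 * (103/100) ^ i \<le> 103/100 * (20 * real (nmem s ''vertices'' 0) / tol)"
      by (intro mult_left_mono) auto
    then show ?thesis
      unfolding Suc by (simp only: power_Suc)
  qed
  ultimately show ?thesis
    using m by blast
qed

text \<open>The ratio of the moduli is \<open>exp (- Re l)\<close> and the angle is
  \<open>\<bar>Im l\<bar>\<close>; the bound 1 on \<open>norm l\<close> keeps \<open>Im l\<close> in
  the range where \<open>arccos\<close> inverts \<open>cos\<close>.\<close>

lemma mult_approx_exp:
  assumes q: "q \<noteq> 0" and l: "norm l \<le> \<epsilon>" "norm l \<le> 1"
  shows "mult_approx \<epsilon> q (q * exp l)"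
proof -
  let ?x = "q * exp l"
  have Re: "\<bar>Re l\<bar> \<le> \<epsilon>" and Im: "\<bar>Im l\<bar> \<le> \<epsilon>" "\<bar>Im l\<bar> \<le> pi"
    using abs_Re_le_cmod[of l] abs_Im_le_cmod[of l] l pi_gt3 by linarith+
  have ratio: "norm q / norm ?x = exp (- Re l)"
    using q by (simp add: norm_mult exp_minus field_simps)
  have conj: "?x * cnj q = complex_of_real ((norm q)\<^sup>2) * exp l"
    unfolding complex_norm_square by (simp only: mult_ac)
  have "inner ?x q = Re (?x * cnj q)"
    by (simp add: inner_complex_def)
  also have "\<dots> = (norm q)\<^sup>2 * (exp (Re l) * cos (Im l))"
    unfolding conj by (simp add: Re_exp del: of_real_power)
  finally have inner: "inner ?x q = (norm q)\<^sup>2 * (exp (Re l) * cos (Im l))" .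
  have "inner ?x q / (norm ?x * norm q) = cos (Im l)"
    unfolding inner norm_mult norm_exp_eq_Re using q by (simp add: power2_eq_square)
  then have "angle ?x q = arccos (cos \<bar>Im l\<bar>)"
    unfolding angle_def by (metis cos_abs_real)
  also have "\<dots> = \<bar>Im l\<bar>"
    using Im by (intro arccos_cos) auto
  finally show ?thesis
    unfolding mult_approx_def ratio using q Re Im by auto
qed

section \<open>Running time and correctness of the program\<close>

lemma nth_concat_rows:
  fixes f :: "nat \<Rightarrow> nat \<Rightarrow> 'a"
  assumes "i < r" "j < k"
  shows "concat (map (\<lambda>i. map (f i) [0..<k]) [0..<r]) ! (k * i + j) = f i j \<and>
    k * i + j < length (concat (map (\<lambda>i. map (f i) [0..<k]) [0..<r]))"
  using assms(1)
proof (induction r)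
  case (Suc r)
  let ?L = "concat (map (\<lambda>i. map (f i) [0..<k]) [0..<r])"
  have len: "length ?L = k * r"
    by (simp add: length_concat comp_def sum_list_triv)
  show ?case
  proof (cases "i < r")
    case True
    then show ?thesis
      using Suc.IH by (simp add: nth_append)
  next
    case False
    then have "i = r" using Suc.prems by simp
    then show ?thesis
      using assms(2) len by (simp add: nth_append)
  qed
qed simp

text \<open>The depth is logarithmic: if \<open>k * D + 1\<close> is at most the \<open>b\<close>-th
  power of 1.03, then its \<open>m\<close>-th power is at most the \<open>b\<close>-th power of
  \<open>1.03 ^ m\<close>, which is linear in \<open>n / tol\<close>.\<close>

lemma running_time_polynomial:
  fixes C0 C1 C2 k D :: nat
  assumes D: "1 \<le> D"
  shows "\<exists>c. \<forall>n m M t :: nat. \<forall>tol :: real. 0 < tol \<and> tol \<le> 1 \<and>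
    (103/100) ^ m \<le> 1 + 103/100 * (20 * real n / tol) \<and> M \<le> n * D \<and>
    t \<le> C0 + C1 * m + C2 * (n * (k * (M + D + 1) * (k * D + 1) ^ Suc m + 1))
    \<longrightarrow> real t \<le> (2 + real n / tol) ^ c"
proof -
  obtain b where b: "real (k * D + 1) \<le> (103/100) ^ b"
    using real_arch_pow[of "103/100" "real (k * D + 1)"] by (auto intro: less_imp_le)
  define K where "K = real C0 + 714 * real C1 + real C2 * (2 * real k * real D * real (k * D + 1) * 21 ^ b + 1)"
  obtain h where h: "K \<le> 2 ^ h"
    using real_arch_pow[of 2 K] by (auto intro: less_imp_le)
  show ?thesis
  proof (intro exI[of _ "h + (b + 2)"] allI impI)
    fix n m M t :: nat and tol :: real
    assume asm: "0 < tol \<and> tol \<le> 1 \<and>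
      (103/100) ^ m \<le> 1 + 103/100 * (20 * real n / tol) \<and> M \<le> n * D \<and>
      t \<le> C0 + C1 * m + C2 * (n * (k * (M + D + 1) * (k * D + 1) ^ Suc m + 1))"
    define X where "X = 2 + real n / tol"
    have n: "real n \<le> real n / tol"
      using asm divide_left_mono[of tol 1 "real n"] by simp
    have X: "2 \<le> X" "real n + 2 \<le> X"
      using asm n by (auto simp: X_def)
    define R where "R = (103/100 :: real) ^ m"
    have "R \<le> 1 + 103/100 * (20 * (real n / tol))"
      unfolding R_def using asm by simp
    moreover have "real n / tol = X - 2" "0 \<le> real n / tol"
      using asm by (simp_all add: X_def)
    ultimately have "R \<le> 21 * X"
      by linarith
    then have r: "(103/100) ^ m \<le> 21 * X"
      by (simp only: R_def)
    have "1 + real m * (3/100) \<le> (1 + 3/100) ^ m"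
      by (rule Bernoulli_inequality) simp
    then have m: "real m \<le> 714 * X"
      using r by simp
    have "real M \<le> real n * real D"
      using asm by (metis of_nat_le_iff of_nat_mult)
    then have "real (M + D + 1) \<le> 2 * real D * (real n + 2)"
      using D by (simp add: algebra_simps)
    also have "\<dots> \<le> 2 * real D * X"
      using X by (intro mult_left_mono) auto
    finally have M: "real (M + D + 1) \<le> 2 * real D * X" .
    have "real (k * D + 1) ^ m \<le> ((103/100) ^ b) ^ m"
      using b by (intro power_mono) auto
    also have "\<dots> = ((103/100) ^ m) ^ b"
      by (simp add: power_mult[symmetric] mult.commute)
    also have "\<dots> \<le> (21 * X) ^ b"
      using r by (intro power_mono) auto
    finally have p: "real (k * D + 1) ^ Suc m \<le> real (k * D + 1) * (21 ^ b * X ^ b)"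
      by (simp add: power_mult_distrib mult_left_mono)
    have "real (k * (M + D + 1) * (k * D + 1) ^ Suc m) = real k * real (M + D + 1) * real (k * D + 1) ^ Suc m"
      by (simp only: of_nat_mult of_nat_power)
    also have "\<dots> \<le> real k * (2 * real D * X) * (real (k * D + 1) * (21 ^ b * X ^ b))"
      using M p X by (intro mult_mono) auto
    also have "\<dots> = 2 * real k * real D * real (k * D + 1) * 21 ^ b * X ^ Suc b"
      by (simp add: mult_ac)
    finally have q: "real (k * (M + D + 1) * (k * D + 1) ^ Suc m + 1) \<le>
        (2 * real k * real D * real (k * D + 1) * 21 ^ b + 1) * X ^ Suc b"
      using one_le_power[of X "Suc b"] X(1)
      by (simp only: of_nat_add of_nat_1 distrib_right mult_1_left) linarith
    have X1: "1 \<le> X ^ (b + 2)" "X \<le> X ^ (b + 2)"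
      using X(1) one_le_power[of X "b + 2"] self_le_power[of X "b + 2"] by auto
    have "real t \<le> real (C0 + C1 * m + C2 * (n * (k * (M + D + 1) * (k * D + 1) ^ Suc m + 1)))"
      using asm of_nat_le_iff by blast
    also have "\<dots> = real C0 + real C1 * real m +
        real C2 * (real n * real (k * (M + D + 1) * (k * D + 1) ^ Suc m + 1))"
      by (simp only: of_nat_add of_nat_mult)
    also have "\<dots> \<le> real C0 * X ^ (b + 2) + real C1 * (714 * X ^ (b + 2)) +
        real C2 * (X * ((2 * real k * real D * real (k * D + 1) * 21 ^ b + 1) * X ^ Suc b))"
    proof (intro add_mono mult_left_mono mult_mono)
      show "real C0 \<le> real C0 * X ^ (b + 2)"
        using X1 by (simp add: mult_le_cancel_left1)
      show "real m \<le> 714 * X ^ (b + 2)"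
        using m X1 by linarith
    qed (use q X in auto)
    also have "\<dots> = K * X ^ (b + 2)"
      by (simp add: K_def algebra_simps)
    \<comment> \<open>As \<open>X\<close> is at least 2, the constant \<open>K\<close> is absorbed
      into the exponent.\<close>
    also have "\<dots> \<le> X ^ h * X ^ (b + 2)"
      using h X power_mono[of 2 X h] by (intro mult_right_mono) auto
    finally show "real t \<le> (2 + real n / tol) ^ (h + (b + 2))"
      by (simp only: power_add X_def)
  qed
qed

lemma array_of_nth: "e < length xs \<Longrightarrow> array_of xs e = xs ! e"
  by (simp add: array_of_def)

text \<open>Distinctness of the edges as sets makes the map from indices to edges injective, so
  counting indices at \<open>v\<close> does not exceed the degree.\<close>

lemma bounded_graph_of_edge_list:
  assumes G: "simple_graph {..<n} E" and deg: "\<forall>v<n. vertex_degree E v \<le> D" and es: "edge_list es E"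
    and "1 \<le> k" "1 \<le> D"
  shows "bounded_graph n (length es) k D (array_of (map fst es)) (array_of (map snd es))"
proof
  let ?x = "array_of (map fst es)" and ?y = "array_of (map snd es)"
  let ?e = "\<lambda>e. {?x e, ?y e}"
  have edge: "map (\<lambda>(u, v). {u, v}) es ! e = ?e e" if "e < length es" for e
    using that by (simp add: array_of_nth case_prod_beta)
  then have E: "?e e \<in> E" if "e < length es" for e
    using es that unfolding edge_list_def by (metis length_map nth_mem)
  have inj: "inj_on ?e {..<length es}"
    using es edge unfolding edge_list_def
    by (metis (no_types, lifting) distinct_conv_nth inj_onI length_map lessThan_iff)
  show "?x e < n \<and> ?y e < n \<and> ?x e \<noteq> ?y e" if "e < length es" for e
  proof -
    have "?e e \<in> E" using E that by blast
    then obtain u v where "u < n" "v < n" "u \<noteq> v" "?e e = {u, v}"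
      using G unfolding simple_graph_def by blast
    then show ?thesis
      by (auto simp: doubleton_eq_iff)
  qed
  show "card {e. e < length es \<and> (?x e = v \<or> ?y e = v)} \<le> D" if "v < n" for v
  proof -
    let ?I = "{e. e < length es \<and> (?x e = v \<or> ?y e = v)}"
    have "card ?I = card (?e ` ?I)"
      by (intro card_image[symmetric] inj_on_subset[OF inj]) auto
    also have "\<dots> \<le> card {e \<in> E. v \<in> e}"
    proof (rule card_mono)
      have "finite E"
        using es unfolding edge_list_def by (metis List.finite_set)
      then show "finite {e \<in> E. v \<in> e}" by simp
      show "?e ` ?I \<subseteq> {e \<in> E. v \<in> e}"
        using E by auto
    qed
    also have "\<dots> \<le> D"
      using deg that by (simp add: vertex_degree_def)
    finally show ?thesis .
  qed
qed (use assms in auto)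

lemma (in bounded_graph) partition_function_eq_Z:
  assumes x: "x = array_of (map fst es)" and y: "y = array_of (map snd es)" and M: "M = length es"
    and es: "edge_list es E" and A: "A \<in> carrier_mat k k" "transpose_mat A = A"
    and w: "\<And>i j. i < k \<Longrightarrow> j < k \<Longrightarrow> w i j = A $$ (i, j)"
  shows "partition_function {..<n} E A = Z w (\<lambda>_. 0) (\<lambda>_. 0)"
proof -
  have "(\<Prod>e\<in>E. edge_weight A \<phi> e) = weight w (\<lambda>_. 0) \<phi>" if \<phi>: "\<phi> \<in> {..<n} \<rightarrow>\<^sub>E {..<k}" for \<phi>
  proof -
    let ?l = "map (\<lambda>(u, v). {u, v}) es"
    have "(\<Prod>e\<in>E. edge_weight A \<phi> e) = prod_list (map (edge_weight A \<phi>) ?l)"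
      using es unfolding edge_list_def by (metis prod.distinct_set_conv_list)
    also have "\<dots> = (\<Prod>e<M. edge_weight A \<phi> {x e, y e})"
      unfolding prod.list_conv_set_nth M
      by (auto simp: atLeast0LessThan x y array_of_nth case_prod_beta intro!: prod.cong)
    also have "\<dots> = (\<Prod>e<M. w (\<phi> (x e)) (\<phi> (y e)))"
    proof (intro prod.cong refl)
      fix e assume "e \<in> {..<M}"
      then have "\<phi> (x e) < k" "\<phi> (y e) < k"
        using \<phi> ends[of e] by auto
      then show "edge_weight A \<phi> {x e, y e} = w (\<phi> (x e)) (\<phi> (y e))"
        by (simp add: edge_weight_eq[OF A] w)
    qed
    finally show ?thesis
      by (simp add: weight_def)
  qed
  moreover have "colourings (\<lambda>_. 0) = {..<n} \<rightarrow>\<^sub>E {..<k}"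
    by (auto simp: colourings_def)
  ultimately show ?thesis
    using A unfolding partition_function_def Z_def by (auto intro!: sum.cong)
qed

text \<open>Besides the straight-line parts it holds one extra round of each loop, from the
  \<open>Suc\<close> in \<open>exec_While\<close>.\<close>

definition init_cost :: "nat \<Rightarrow> nat" where
  "init_cost k = run_cost prepare + (1 + tcost depth_test + run_cost depth_body) +
     run_cost (first_root k) + (1 + tcost root_test + run_cost (body k))"

lemma program_correct:
  assumes G: "simple_graph {..<n} E" and deg: "\<forall>v<n. vertex_degree E v \<le> D" and es: "edge_list es E"
    and kD: "1 \<le> k" "1 \<le> D" and A: "A \<in> carrier_mat k k" "transpose_mat A = A"
    and near: "\<forall>i<k. \<forall>j<k. cmod (A $$ (i, j) - 1) \<le> 0.34 / real D"
    and eps: "0 < \<epsilon>"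
  shows "\<exists>t s m. exec (program k) (initial_state n es A \<epsilon>) t s \<and>
    mult_approx \<epsilon> (partition_function {..<n} E A) (result s) \<and>
    (103/100) ^ m \<le> 1 + 103/100 * (20 * real n / min 1 \<epsilon>) \<and> length es \<le> n * D \<and>
    t \<le> init_cost k + (1 + tcost depth_test + run_cost depth_body) * m +
      (1 + tcost root_test + run_cost (body k)) *
        (n * (k * (length es + D + 1) * (k * D + 1) ^ Suc m + 1))"
proof -
  define s0 tol where "s0 = initial_state n es A \<epsilon>" and "tol = min 1 \<epsilon>"
  define x y where "x = array_of (map fst es)" and "y = array_of (map snd es)"
  define mat where "mat = array_of [A $$ (i, j). i \<leftarrow> [0..<dim_row A], j \<leftarrow> [0..<dim_col A]]"
  have dims: "dim_row A = k" "dim_col A = k"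
    using A by auto
  have tol: "0 < tol" "tol \<le> 1" "tol \<le> \<epsilon>"
    using eps by (auto simp: tol_def)
  have "cmem s0 ''eps'' 0 = complex_of_real \<epsilon>" "nmem s0 ''max'' 0 = 0" and n: "nmem s0 ''vertices'' 0 = n"
    by (simp_all add: s0_def initial_state_def array_of_def)
  from run_prepare[OF this(1,2)] have prep: "run prepare s0 = depth_state s0 tol 0"
    by (simp add: tol_def)
  obtain m where m: "iterates depth_test depth_body m (depth_state s0 tol 0) (depth_state s0 tol m)"
    "\<not> tval depth_test (depth_state s0 tol m)" "(103/100) ^ m \<le> 1 + 103/100 * (20 * real n / tol)"
    using depth_loop[OF tol(1), of s0] n by auto
  have deep: "20 * real n / tol \<le> (103/100) ^ m"
    using m(2) tol n by (simp add: tval_depth_test field_simps)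
  interpret bounded_graph n "length es" k D x y
    unfolding x_def y_def by (rule bounded_graph_of_edge_list[OF G deg es kD])
  interpret tree_computation n "length es" k D m x y mat ..
  have a: "a i j = A $$ (i, j)" if "i < k" "j < k" for i j
  proof -
    have "mat (k * i + j) = A $$ (i, j)"
      using nth_concat_rows[OF that, of "\<lambda>i j. A $$ (i, j)"]
      by (simp add: mat_def dims array_of_def)
    then show ?thesis by (simp only: a_def)
  qed
  define s1 s2 where "s1 = depth_state s0 tol m" and "s2 = run (first_root k) s1"
  have in2: "inputs s2"
    unfolding inputs_def
    by (simp add: s2_def s1_def first_root_def run_set_ones depth_state_def s0_def
        initial_state_def nstore_def cstore_def x_def y_def mat_def array_of_def)
  have view2: "view s2 = \<lparr> pin = (\<lambda>_. 0)(0 := 1), ptr = (\<lambda>_. 0), par = (\<lambda>_. 0), cur = 0, dep = 0, root = 0,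
      vec = ones_at k 0 k (\<lambda>_. 0), res = 1 \<rparr>"
    by (simp add: s2_def s1_def view_def first_root_def run_set_ones depth_state_def s0_def
        initial_state_def nstore_def cstore_def)
  have "root_state 0 (view s2)"
    using vec_at_ones_at[of _ 0 "\<lambda>_. 0" 0]
    by (simp add: root_state_def view2 root_pointers_def vec_at_def)
  from all_roots[OF this] obtain j \<tau> where j: "j \<le> n * (visit_steps (Suc m) + 1)"
    "reach j (view s2) \<tau>" "root_state n \<tau>" by blast
  obtain s3 where s3: "iterates root_test (body k) j s2 s3" "view s3 = \<tau>" "inputs s3"
    using iterates_reach[OF in2 j(2)] by (auto simp: root_test_def)
  have "\<not> tval root_test s3"
    using s3(2,3) j(3) by (auto simp: root_test_def root_state_def view_def inputs_def)
  from exec_While[OF loop_free_body s3(1) this] obtain t4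
    where t4: "t4 \<le> Suc j * (1 + tcost root_test + run_cost (body k))" "exec (While root_test (body k)) s2 t4 s3"
    by blast
  obtain t1 where t1: "t1 \<le> run_cost prepare" "exec prepare s0 t1 (depth_state s0 tol 0)"
    using exec_run[OF loop_free_parts(1), of s0] prep by auto
  obtain t2 where t2: "t2 \<le> Suc m * (1 + tcost depth_test + run_cost depth_body)"
    "exec (While depth_test depth_body) (depth_state s0 tol 0) t2 s1"
    using exec_While[OF loop_free_parts(2) m(1,2)] by (auto simp: s1_def)
  obtain t3 where t3: "t3 \<le> run_cost (first_root k)" "exec (first_root k) s1 t3 s2"
    using exec_run[OF loop_free_parts(3), of k s1] by (auto simp: s2_def)
  have exec: "exec (program k) s0 (t1 + (t2 + (t3 + t4))) s3"
    unfolding program_def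
    by (rule exec.Seq[OF t1(2) exec.Seq[OF t2(2) exec.Seq[OF t3(2) t4(2)]]])
  have Z: "partition_function {..<n} E A = Z a (\<lambda>_. 0) (\<lambda>_. 0)"
    by (rule partition_function_eq_Z[OF x_def y_def refl es A a])
  have sym: "\<forall>i<k. \<forall>j<k. a i j = a j i"
    using A dims a by (metis index_transpose_mat(1))
  have near': "\<forall>i<k. \<forall>j<k. norm (a i j - 1) \<le> 17/50 / real D"
    using near a by simp
  note approx = prod_Y_ratio[OF near' sym tol(1,2), of "Suc m"]
  \<comment> \<open>The tree has depth \<open>m + 1\<close>, one more than the depth that passed the
    test.\<close>
  have "20 * real n / tol \<le> (103/100) ^ Suc m"
    by (rule order_trans[OF deep power_increasing]) auto
  from approx[OF this] obtain l where "Z a (\<lambda>_. 0) (\<lambda>_. 0) \<noteq> 0"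
    "(\<Prod>r<n. Y a (Suc m) r) = Z a (\<lambda>_. 0) (\<lambda>_. 0) * exp l" "norm l \<le> tol"
    by blast
  moreover have "result s3 = (\<Prod>r<n. Y a (Suc m) r)"
    using s3(2) j(3) by (auto simp: result_def root_state_def view_def)
  ultimately have "mult_approx \<epsilon> (partition_function {..<n} E A) (result s3)"
    using mult_approx_exp[of "Z a (\<lambda>_. 0) (\<lambda>_. 0)" l \<epsilon>] tol by (simp add: Z)
  moreover have "t1 + (t2 + (t3 + t4)) \<le>
      init_cost k + (1 + tcost depth_test + run_cost depth_body) * m +
      (1 + tcost root_test + run_cost (body k)) *
        (n * (k * (length es + D + 1) * (k * D + 1) ^ Suc m + 1))"
  proof -
    define C1 where "C1 = 1 + tcost depth_test + run_cost depth_body"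
    define C2 where "C2 = 1 + tcost root_test + run_cost (body k)"
    define J where "J = n * (k * (length es + D + 1) * (k * D + 1) ^ Suc m + 1)"
    have "j \<le> J"
      using j(1) visit_steps_le[of "Suc m"] unfolding J_def
      by (meson add_right_mono le_trans mult_left_mono zero_le)
    then have "Suc j * C2 \<le> Suc J * C2"
      by (intro mult_right_mono) auto
    moreover have "t4 \<le> Suc j * C2" "t2 \<le> Suc m * C1"
      using t4(1) t2(1) by (simp_all only: C1_def C2_def)
    ultimately have "t4 \<le> Suc J * C2" "t2 \<le> Suc m * C1"
      by (blast intro: le_trans)+
    then have "t4 \<le> C2 + C2 * J" "t2 \<le> C1 + C1 * m"
      by (simp_all add: mult.commute)
    then have "t1 + (t2 + (t3 + t4)) \<le>
        (run_cost prepare + C1 + run_cost (first_root k) + C2) + C1 * m + C2 * J"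
      using t1(1) t3(1) by linarith
    then show ?thesis
      by (simp only: init_cost_def C1_def C2_def J_def)
  qed
  ultimately show ?thesis
    using exec m(3) edges_le unfolding s0_def tol_def by (intro exI conjI)
qed

text \<open>The witness program depends only on \<open>k\<close>; \<open>\<Delta>\<close> enters
  through the exponent. A base of at least 2 allows constant factors to be moved into the
  exponent.\<close>

theorem theorem1p4:
  fixes \<Delta> k :: nat
  assumes "\<Delta> \<ge> 1" and "k \<ge> 1"
  shows "\<exists>(P :: com) (c :: nat).
    \<forall>(n :: nat) (E :: nat set set) (es :: (nat \<times> nat) list) (A :: complex mat) (\<epsilon> :: real).
      simple_graph {..<n} E \<and> (\<forall>v<n. vertex_degree E v \<le> \<Delta>) \<and> edge_list es E \<and>
      A \<in> carrier_mat k k \<and> transpose_mat A = A \<and>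
      (\<forall>i<k. \<forall>j<k. cmod (A $$ (i, j) - 1) \<le> 0.34 / real \<Delta>) \<and>
      \<epsilon> > 0 \<longrightarrow>
      (\<exists>t s. exec P (initial_state n es A \<epsilon>) t s \<and>
        mult_approx \<epsilon> (partition_function {..<n} E A) (result s) \<and>
        real t \<le> (2 + real n / min 1 \<epsilon>) ^ c)"
proof -
  let ?C1 = "1 + tcost depth_test + run_cost depth_body"
  let ?C2 = "1 + tcost root_test + run_cost (body k)"
  obtain c where c: "\<And>n m M t (tol :: real). 0 < tol \<and> tol \<le> 1 \<and>
    (103/100) ^ m \<le> 1 + 103/100 * (20 * real n / tol) \<and> M \<le> n * \<Delta> \<and>
    t \<le> init_cost k + ?C1 * m + ?C2 * (n * (k * (M + \<Delta> + 1) * (k * \<Delta> + 1) ^ Suc m + 1))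
    \<Longrightarrow> real t \<le> (2 + real n / tol) ^ c"
    using running_time_polynomial[OF assms(1), of "init_cost k" ?C1 ?C2 k] by blast
  show ?thesis
  proof (rule exI[of _ "program k"], rule exI[of _ c], intro allI impI, elim conjE)
    fix n E es A and \<epsilon> :: real
    assume "simple_graph {..<n} E" "\<forall>v<n. vertex_degree E v \<le> \<Delta>" "edge_list es E"
      "A \<in> carrier_mat k k" "transpose_mat A = A"
      "\<forall>i<k. \<forall>j<k. cmod (A $$ (i, j) - 1) \<le> 0.34 / real \<Delta>" and eps: "\<epsilon> > 0"
    from program_correct[OF this(1-3) assms(2,1) this(4-7)] obtain t s m
      where run: "exec (program k) (initial_state n es A \<epsilon>) t s"
        "mult_approx \<epsilon> (partition_function {..<n} E A) (result s)"
        and "(103/100) ^ m \<le> 1 + 103/100 * (20 * real n / min 1 \<epsilon>)" "length es \<le> n * \<Delta>"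
        "t \<le> init_cost k + ?C1 * m + ?C2 * (n * (k * (length es + \<Delta> + 1) * (k * \<Delta> + 1) ^ Suc m + 1))"
      by blast
    then have "real t \<le> (2 + real n / min 1 \<epsilon>) ^ c"
      using eps by (intro c[of "min 1 \<epsilon>" m n "length es" t]) auto
    with run show "\<exists>t s. exec (program k) (initial_state n es A \<epsilon>) t s \<and>
        mult_approx \<epsilon> (partition_function {..<n} E A) (result s) \<and>
        real t \<le> (2 + real n / min 1 \<epsilon>) ^ c"
      by blast
  qed
qed

end
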